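(* Assume the linear model with tie probability $T(s)=1-2\beta$ for $\beta\in(0,\tfrac12)$ (as defined in the context), and let $\mu=\mathbb E[X_\sigma]$, which does not depend on the ordering $\sigma$. Let $k\in\{0,\tfrac12,1,\dots,n-\tfrac12,n\}$. (1) If $k\ge\mu+2.5$, then, over all orderings $\sigma$, $\mathbb P(X_\sigma\ge k)$ is maximized by $\sigma=(1,2,\dots,n)$ (strong-vs-strong), i.e. $\sigma(i)=i$ for all $i$. (2) If $k\le\mu-2$, then, over all orderings $\sigma$, $\mathbb P(X_\sigma\ge k)$ is maximized by $\sigma=(n,n-1,\dots,1)$ (strong-vs-weak), i.e. $\sigma(i)=n+1-i$ for all $i$. (3) For $k\in(\mu-2,\mu+2.5)$, the optimal ordering (the ordering $\sigma$ maximizing $\mathbb P(X_\sigma\ge k)$) may depend on how the teams $A$ and $B$ are chosen.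
   Context: Let $n\ge1$. Team $A$ has players of strengths $a_1\ge a_2\ge\dots\ge a_n$ and team $B$ has players of strengths $b_1\ge b_2\ge\dots\ge b_n$ (real numbers). An ordering is a permutation $\sigma$ of $\{1,\dots,n\}$, written in one-line notation $(\sigma(1),\dots,\sigma(n))$; in match $i$, player $\sigma(i)$ of team $B$ plays player $i$ of team $A$. The random variable $X_{j,i}$ is the number of points earned by team $B$ when its player $j$ faces player $i$ of team $A$: $1$ for a win, $\tfrac12$ for a tie, $0$ for a loss. The total score of team $B$ under the ordering $\sigma$ is $X_\sigma=X_{\sigma(1),1}+\dots+X_{\sigma(n),n}$, where the match outcomes $X_{\sigma(1),1},\dots,X_{\sigma(n),n}$ are independent. In the linear model with constants $\alpha>0$ and $\beta\in[0,\tfrac12]$, writing $s=b_j-a_i$ for the strength differential, $\mathbb P(X_{j,i}=1)=W(s)=\alpha s+\beta$, $\mathbb P(X_{j,i}=0)=L(s)=-\alpha s+\beta$, and $\mathbb P(X_{j,i}=\tfrac12)=T(s)=1-2\beta$; all possible strength differentials are assumed to lie in $(-\tfrac{\beta}{\alpha},\tfrac{\beta}{\alpha})\cap(\tfrac{\beta-1}{\alpha},\tfrac{1-\beta}{\alpha})$. *)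

theory Defs
  imports "HOL-Probability.Probability" "HOL-Combinatorics.Permutations"
begin

text \<open>
  Players are numbered from \<open>1\<close> to \<open>n\<close>, strongest first: \<open>a i\<close> and \<open>b j\<close> are the strengths of
  player \<open>i\<close> of team A and player \<open>j\<close> of team B; values outside \<open>{1..n}\<close> are irrelevant.
  \<open>X j i\<close> is the number of points earned by player \<open>j\<close> of team B against player \<open>i\<close> of team A.
  An ordering is a \<open>\<sigma>\<close> with \<open>\<sigma> permutes {1..n}\<close>; player \<open>\<sigma> i\<close> of B plays player \<open>i\<close> of A.
\<close>

definition total_score :: "nat \<Rightarrow> (nat \<Rightarrow> nat \<Rightarrow> 'w \<Rightarrow> real) \<Rightarrow> (nat \<Rightarrow> nat) \<Rightarrow> 'w \<Rightarrow> real" where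
  "total_score n X \<sigma> \<omega> = (\<Sum>i = 1..n. X (\<sigma> i) i \<omega>)"

text \<open>
  Independence is required only among the matches played under one and the same ordering.
\<close>

definition linear_model ::
  "real \<Rightarrow> real \<Rightarrow> nat \<Rightarrow> (nat \<Rightarrow> real) \<Rightarrow> (nat \<Rightarrow> real) \<Rightarrow> 'w measure \<Rightarrow>
    (nat \<Rightarrow> nat \<Rightarrow> 'w \<Rightarrow> real) \<Rightarrow> bool" where
  "linear_model \<alpha> \<beta> n a b M X \<longleftrightarrow>
     1 \<le> n \<and>
     (\<forall>i\<in>{1..n}. \<forall>j\<in>{1..n}. i \<le> j \<longrightarrow> a j \<le> a i \<and> b j \<le> b i) \<and>
     (\<forall>i\<in>{1..n}. \<forall>j\<in>{1..n}.
        b j - a i \<in> {- (\<beta> / \<alpha>)<..<\<beta> / \<alpha>} \<inter> {(\<beta> - 1) / \<alpha><..<(1 - \<beta>) / \<alpha>}) \<and>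
     prob_space M \<and>
     (\<forall>i\<in>{1..n}. \<forall>j\<in>{1..n}.
        X j i \<in> borel_measurable M \<and>
        (\<forall>\<omega>\<in>space M. X j i \<omega> \<in> {0, 1 / 2, 1}) \<and>
        \<P>(\<omega> in M. X j i \<omega> = 1) = \<alpha> * (b j - a i) + \<beta> \<and>
        \<P>(\<omega> in M. X j i \<omega> = 0) = - \<alpha> * (b j - a i) + \<beta> \<and>
        \<P>(\<omega> in M. X j i \<omega> = 1 / 2) = 1 - 2 * \<beta>) \<and>
     (\<forall>\<sigma>. \<sigma> permutes {1..n} \<longrightarrow>
        prob_space.indep_vars M (\<lambda>_. borel) (\<lambda>i. X (\<sigma> i) i) {1..n})"

definition expected_score ::
  "nat \<Rightarrow> 'w measure \<Rightarrow> (nat \<Rightarrow> nat \<Rightarrow> 'w \<Rightarrow> real) \<Rightarrow> (nat \<Rightarrow> nat) \<Rightarrow> real" where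
  "expected_score n M X \<sigma> = (\<integral>\<omega>. total_score n X \<sigma> \<omega> \<partial>M)"

definition optimal_ordering ::
  "nat \<Rightarrow> 'w measure \<Rightarrow> (nat \<Rightarrow> nat \<Rightarrow> 'w \<Rightarrow> real) \<Rightarrow> real \<Rightarrow> (nat \<Rightarrow> nat) \<Rightarrow> bool" where
  "optimal_ordering n M X k \<sigma> \<longleftrightarrow>
     \<sigma> permutes {1..n} \<and>
     (\<forall>\<tau>. \<tau> permutes {1..n} \<longrightarrow>
        \<P>(\<omega> in M. k \<le> total_score n X \<tau> \<omega>) \<le> \<P>(\<omega> in M. k \<le> total_score n X \<sigma> \<omega>))"

definition strong_vs_strong :: "nat \<Rightarrow> nat" where
  "strong_vs_strong i = i"

text \<open>Extended by the identity outside \<open>{1..n}\<close>, as \<open>permutes\<close> demands.\<close>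

definition strong_vs_weak :: "nat \<Rightarrow> nat \<Rightarrow> nat" where
  "strong_vs_weak n i = (if i \<in> {1..n} then n + 1 - i else i)"

definition half_integers_upto :: "nat \<Rightarrow> real set" where
  "half_integers_upto n = {real m / 2 | m. m \<le> 2 * n}"

end

theory Submission
  imports Defs "HOL-Computational_Algebra.Fundamental_Theorem_Algebra"
begin

text \<open>
  Twice the score of a match has the generating function \<open>Q + x (z\<^sup>2 - 1)\<close>, where
  \<open>Q = \<beta> + (1 - 2\<beta>) z + \<beta> z\<^sup>2\<close> does not depend on the players and \<open>x = \<alpha> s\<close> (called the
  offset below) is proportional to the strength differential. Suppose that two players of team B
  exchange their opponents. The sum of the two offsets stays the same, and their product grows by
  \<open>\<delta> = \<alpha>\<^sup>2 (a\<^sub>i - a\<^sub>j) (b - b')\<close>, which is nonnegative when the exchange puts the stronger player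
  of B against the stronger player of A. So the generating function of twice the total score grows
  by \<open>\<delta> (z\<^sup>2 - 1)\<^sup>2 R\<close>, where \<open>R\<close> belongs to the other matches. Summing coefficients from \<open>K\<close> on
  amounts to dividing by \<open>1 - z\<close>, so \<open>P(2 X \<ge> K)\<close> grows by \<open>\<delta> (U\<^sub>K\<^sub>-\<^sub>3 - U\<^sub>K\<^sub>-\<^sub>1)\<close> with
  \<open>U = (1 + z) R\<close> (\<open>upper_tail_swap_players\<close>). Everything depends on the sign of this difference.

  The coefficients \<open>U\<^sub>j\<close> for even \<open>j\<close>, and those for odd \<open>j\<close>, are separately unimodal. All factors
  of \<open>U\<close> have their roots in the left half plane, so by the Hermite-Biehler argument the even and
  the odd part of \<open>U\<close>, as polynomials in \<open>z\<^sup>2\<close>, have only real nonpositive roots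
  (\<open>nonpos_rooted_parity\<close>). Up to a positive factor each of them is therefore the generating
  function of a sum of independent Bernoulli variables, and by a theorem of Darroch its
  coefficients increase up to the mean and decrease after it (\<open>poisson_binomial_coeff_decreasing\<close>,
  \<open>nonpos_rooted_mode\<close>). Because \<open>U\<close> vanishes at \<open>-1\<close>, the two parts carry the same mass, and if
  \<open>m\<close> is the mean of \<open>R\<close>, then the mean index of the coefficients in either part lies in
  \<open>[m, m + 1]\<close> (\<open>smoothed_coeff_mode\<close>). Finally \<open>m\<close> differs from the mean \<open>2 \<mu>\<close> of twice the total
  score by the two removed matches, each of which contributes between \<open>0\<close> and \<open>2\<close>. Hence no exchange
  towards strong-vs-strong lowers the probability if \<open>K \<ge> 2 \<mu> + 5\<close>, and none raises it if
  \<open>K \<le> 2 \<mu> - 4\<close>; and every ordering is connected with each of the two extreme ones by exchanges that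
  all go in the same direction.

  In between, consider teams whose players are all equal except for one stronger player on each
  side. Only one choice matters: whether the two stronger players meet. Its effect has the sign of
  \<open>U\<^sub>K\<^sub>-\<^sub>3 - U\<^sub>K\<^sub>-\<^sub>1\<close> for \<open>R = (Q + x (z\<^sup>2 - 1))\<^sup>N\<close> and \<open>K = N + 3\<close>, a polynomial in \<open>x\<close> that takes
  both signs when \<open>N\<close> is large. So it takes both signs at two arbitrarily close values of \<open>x\<close>, and a small change of the
  strength of one player makes the two expected scores equal (\<open>optimum_depends_on_teams\<close>).
\<close>

section \<open>The mode of a sum of independent Bernoulli variables\<close>

lemma coeff_prod_nonneg:
  fixes f :: "'i \<Rightarrow> real poly"
  assumes "\<And>i k. i \<in> S \<Longrightarrow> 0 \<le> coeff (f i) k"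
  shows "0 \<le> coeff (prod f S) k"
  using assms
proof (induction S arbitrary: k rule: infinite_finite_induct)
  case (insert i S)
  then show ?case
    by (auto simp: coeff_mult intro!: sum_nonneg mult_nonneg_nonneg)
qed auto

lemma bernoulli_gf_mult:
  fixes x y :: "'a :: comm_ring_1"
  shows "[:1 - x, x:] * [:1 - y, y:] = [:1 - (x + y), x + y:] + smult (x * y) ([:-1, 1:]\<^sup>2)"
  by (simp add: power2_eq_square algebra_simps)

text \<open>
  The differential equation \<open>(1 - a + a y) P' = n a P\<close> relates consecutive coefficients of
  \<open>P = (1 - a + a y)\<^sup>n\<close>. The factors \<open>Suc k\<close> and \<open>k\<close>, sharper than comparing the coefficients
  themselves, later give strict inequalities for nonzero coefficients.
\<close>

lemma binomial_coeff_decreasing: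
  fixes a :: real
  assumes "0 < a" "a < 1" "real n * a \<le> real k"
  shows "real (Suc k) * coeff ([:1 - a, a:] ^ n) (Suc k) \<le> real k * coeff ([:1 - a, a:] ^ n) k"
proof -
  define P where "P = [:1 - a, a:] ^ n"
  have P0: "coeff P k \<ge> 0"
    using coeff_prod_nonneg[of "{..<n}" "\<lambda>_. [:1 - a, a:]" k] assms
    by (auto simp: P_def coeff_pCons split: nat.splits)
  have "[:1 - a, a:] * pderiv P = smult (real n * a) P"
    by (cases n) (simp_all add: P_def pderiv_power_Suc pderiv_pCons algebra_simps del: power_Suc, simp add: add.commute)
  then have "coeff ([:1 - a, a:] * pderiv P) k = real n * a * coeff P k"
    by simp
  moreover have "coeff ([:1 - a, a:] * pderiv P) k = (1 - a) * (real (Suc k) * coeff P (Suc k)) + a * (real k * coeff P k)"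
    by (cases k) (simp_all add: coeff_pderiv algebra_simps)
  ultimately have "(1 - a) * (real (Suc k) * coeff P (Suc k)) = (real n * a - real k * a) * coeff P k"
    by (simp add: algebra_simps)
  also have "\<dots> \<le> (real k - real k * a) * coeff P k"
    using assms P0 by (intro mult_right_mono) auto
  also have "\<dots> = (1 - a) * (real k * coeff P k)"
    by (simp add: algebra_simps)
  finally show ?thesis using assms(2) by (simp add: P_def)
qed

text \<open>
  Half of Darroch's theorem on the mode, proved by smoothing as in Hoeffding's work on the same
  distribution. Fix all but two of the probabilities and also the sum of these two. Then every
  linear functional of the generating function is affine in their product. If it grows as the
  product gets smaller, the two can be moved apart until one of them is \<open>0\<close> or \<open>1\<close> and drops out;
  otherwise they can be moved together until one of them equals the average. What remains in the
  end is the binomial distribution.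
\<close>

lemma poisson_binomial_coeff_decreasing:
  fixes p :: "'i \<Rightarrow> real"
  assumes "finite S" "\<And>i. i \<in> S \<Longrightarrow> 0 \<le> p i \<and> p i \<le> 1" "sum p S \<le> real k"
  shows "real (Suc k) * coeff (\<Prod>i\<in>S. [:1 - p i, p i:]) (Suc k) \<le>
         real k * coeff (\<Prod>i\<in>S. [:1 - p i, p i:]) k"
  using assms
proof (induction "card S" arbitrary: S p k rule: less_induct)
  case (less S p k)
  define drop where "drop P = real (Suc k) * coeff P (Suc k) - real k * coeff P k" for P :: "real poly"
  define G where "G q T = (\<Prod>i\<in>T. [:1 - q i, q i:])" for q :: "'i \<Rightarrow> real" and T :: "'i set"
  have drop_add: "drop (P + Q) = drop P + drop Q" for P Q
    by (simp add: drop_def algebra_simps)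
  have drop_smult: "drop (smult c P) = c * drop P" for c P
    by (simp add: drop_def algebra_simps)
  \<comment> \<open>A probability \<open>0\<close> contributes the factor \<open>1\<close>, and a probability \<open>1\<close> the factor \<open>y\<close>,
  which lowers both the mean and the index by one.\<close>
  have boundary: "drop (G q S) \<le> 0"
    if q: "\<And>i. i \<in> S \<Longrightarrow> 0 \<le> q i \<and> q i \<le> 1" and le: "sum q S \<le> real k"
      and i: "i \<in> S" and qi: "q i = 0 \<or> q i = 1" for q i
  proof -
    have card: "card (S - {i}) < card S"
      using less.prems(1) i by (rule card_Diff1_less)
    have split: "G q S = [:1 - q i, q i:] * G q (S - {i})"
      unfolding G_def by (rule prod.remove[OF less.prems(1) i])
    have ssplit: "sum q S = q i + sum q (S - {i})"
      using sum.remove[OF less.prems(1) i] by simp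
    show ?thesis
    proof (cases "q i = 0")
      case True
      have "real (Suc k) * coeff (G q (S - {i})) (Suc k) \<le> real k * coeff (G q (S - {i})) k"
        unfolding G_def
        by (rule less.hyps[OF card]) (use less.prems q le ssplit True in auto)
      then show ?thesis using True by (simp add: split drop_def)
    next
      case False
      then have q1: "q i = 1" using qi by simp
      have nn: "sum q (S - {i}) \<ge> 0" using q by (intro sum_nonneg) auto
      have "k \<noteq> 0" using nn le ssplit q1 by auto
      then obtain l where l: "k = Suc l" by (cases k) auto
      have *: "real (Suc l) * coeff (G q (S - {i})) (Suc l) \<le> real l * coeff (G q (S - {i})) l"
        unfolding G_def
        by (rule less.hyps[OF card]) (use less.prems q le ssplit q1 l in auto)
      have cl: "coeff (G q (S - {i})) l \<ge> 0" unfolding G_def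
        by (rule coeff_prod_nonneg) (use q in \<open>auto simp: coeff_pCons split: nat.splits\<close>)
      define f where "f = coeff (G q (S - {i}))"
      have "real (Suc (Suc l)) * f (Suc l) \<le> real (Suc l) * f l"
      proof -
        have "real (Suc l) * (real (Suc (Suc l)) * f (Suc l)) = real (Suc (Suc l)) * (real (Suc l) * f (Suc l))"
          by simp
        also have "\<dots> \<le> real (Suc (Suc l)) * (real l * f l)"
          using * by (intro mult_left_mono) (auto simp: f_def)
        also have "\<dots> \<le> real (Suc l) * (real (Suc l) * f l)"
          using cl by (simp add: f_def algebra_simps)
        finally show ?thesis by (subst (asm) mult_le_cancel_left_pos) auto
      qed
      then show ?thesis using q1 by (simp add: split drop_def l f_def)
    qed
  qed
  define a where "a = sum p S / real (card S)"
  have "drop (G p S) \<le> 0"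
    using less.prems(2,3) a_def
  proof (induction "card {i \<in> S. p i \<noteq> a}" arbitrary: p rule: less_induct)
    case (less p)
    note p01 = less.prems(1) and le = less.prems(2) and a = less.prems(3)
    have fin: "finite S" by fact
    show ?case
    proof (cases "\<exists>i\<in>S. p i = 0 \<or> p i = 1")
      case True
      then show ?thesis using boundary[OF p01 le] by auto
    next
      case False
      then have p: "0 < p i" "p i < 1" if "i \<in> S" for i using p01[OF that] that by force+
      show ?thesis
      proof (cases "\<forall>i\<in>S. p i = a")
        case True
        then have GP: "G p S = [:1 - a, a:] ^ card S" by (simp add: G_def)
        show ?thesis
        proof (cases "S = {}")
          case True
          then show ?thesis by (simp add: G_def drop_def)
        next
          case False
          then obtain i where "i \<in> S" by auto
          then have "0 < a" "a < 1" using p True by auto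
          moreover have "real (card S) * a \<le> real k" using le a fin False by simp
          ultimately show ?thesis using binomial_coeff_decreasing[of a "card S" k]
            by (simp add: GP drop_def)
        qed
      next
        case nonconst: False
        then have ne: "S \<noteq> {}" by auto
        have suma: "sum p S = (\<Sum>i\<in>S. a)" using a ne fin by simp
        have "\<exists>i\<in>S. p i < a"
        proof (rule ccontr)
          assume "\<not> ?thesis"
          then have 1: "\<And>i. i \<in> S \<Longrightarrow> a \<le> p i" by force
          moreover have "\<exists>i\<in>S. a < p i" using 1 nonconst by force
          ultimately have "(\<Sum>i\<in>S. a) < sum p S" using fin by (intro sum_strict_mono_ex1) auto
          then show False using suma by simp
        qed
        then obtain i where i: "i \<in> S" "p i < a" by auto
        have "\<exists>i\<in>S. a < p i"
        proof (rule ccontr)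
          assume "\<not> ?thesis"
          then have 1: "\<And>i. i \<in> S \<Longrightarrow> p i \<le> a" by force
          moreover have "\<exists>i\<in>S. p i < a" using i by auto
          ultimately have "sum p S < (\<Sum>i\<in>S. a)" using fin by (intro sum_strict_mono_ex1) auto
          then show False using suma by simp
        qed
        then obtain j where j: "j \<in> S" "a < p j" by auto
        have ij: "i \<noteq> j" using i j by auto
        define H where "H = G p (S - {i} - {j})"
        \<comment> \<open>The coefficient of the product of the two probabilities in the functional.\<close>
        define C where "C = drop ([:-1, 1:]\<^sup>2 * H)"
        have expand: "drop (G q S) =
            drop ([:1 - (q i + q j), q i + q j:] * H) + q i * q j * C"
          if "\<And>l. l \<in> S - {i} - {j} \<Longrightarrow> q l = p l" for q
        proof -
          have "G q S = [:1 - q i, q i:] * ([:1 - q j, q j:] * G q (S - {i} - {j}))"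
            unfolding G_def using i j ij fin
            by (subst prod.remove[of S i], simp, simp, subst prod.remove[of "S - {i}" j]) auto
          also have "G q (S - {i} - {j}) = H" unfolding H_def G_def
            using that by (intro prod.cong) auto
          finally have "G q S = ([:1 - q i, q i:] * [:1 - q j, q j:]) * H"
            by (simp only: mult.assoc)
          also have "\<dots> = [:1 - (q i + q j), q i + q j:] * H + smult (q i * q j) ([:-1, 1:]\<^sup>2 * H)"
            by (simp only: bernoulli_gf_mult distrib_right mult_smult_left)
          finally show ?thesis by (simp add: drop_add drop_smult C_def)
        qed
        define move where "move d = p(i := p i + d, j := p j - d)" for d
        have move_sum: "sum (move d) S = sum p S" for d
        proof -
          have *: "sum q S = q i + (q j + sum q (S - {i} - {j}))" for q :: "'i \<Rightarrow> real"
            using i j ij fin by (subst sum.remove[of S i], simp, simp, subst sum.remove[of "S - {i}" j]) auto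
          have "sum (move d) (S - {i} - {j}) = sum p (S - {i} - {j})"
            by (intro sum.cong) (auto simp: move_def)
          then show ?thesis using ij by (simp add: * move_def)
        qed
        have move_drop: "drop (G (move d) S) = drop (G p S) + d * (p j - p i - d) * C" for d
          using expand[of p] expand[of "move d"] ij by (simp add: move_def algebra_simps)
        show ?thesis
        proof (cases "C < 0")
          case True
          define d where "d = min (p i) (1 - p j)"
          have d: "0 < d" "d \<le> p i" "d \<le> 1 - p j" "d = p i \<or> d = 1 - p j"
            using p[OF i(1)] p[OF j(1)] by (auto simp: d_def min_def)
          have "drop (G (move (-d)) S) \<le> 0"
          proof (rule disjE[OF d(4)])
            assume "d = p i"
            then show ?thesis using p01 le move_sum[of "-d"] d i j ij
              by (intro boundary[where i=i]) (auto simp: move_def intro: order_trans[of _ "p j"])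
          next
            assume "d = 1 - p j"
            then show ?thesis using p01 le move_sum[of "-d"] d i j ij
              by (intro boundary[where i=j]) (auto simp: move_def)
          qed
          moreover have "(-d) * (p j - p i + d) * C \<ge> 0"
            using d i j True by (intro mult_nonpos_nonpos) (auto intro!: mult_nonneg_nonneg)
          ultimately show ?thesis using move_drop[of "-d"] by simp
        next
          case False
          define d where "d = a - p i"
          have d: "0 < d" "d < p j - p i" using i j by (auto simp: d_def)
          have "drop (G (move d) S) \<le> 0"
          proof (rule less.hyps)
            show "card {l \<in> S. move d l \<noteq> a} < card {l \<in> S. p l \<noteq> a}"
            proof (rule psubset_card_mono)
              show "finite {l \<in> S. p l \<noteq> a}" using fin by simp
              have "i \<in> {l \<in> S. p l \<noteq> a}" "i \<notin> {l \<in> S. move d l \<noteq> a}"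
                using i ij by (auto simp: move_def d_def)
              moreover have "{l \<in> S. move d l \<noteq> a} \<subseteq> {l \<in> S. p l \<noteq> a}"
                using i j by (auto simp: move_def d_def)
              ultimately show "{l \<in> S. move d l \<noteq> a} \<subset> {l \<in> S. p l \<noteq> a}" by blast
            qed
            show "0 \<le> move d l \<and> move d l \<le> 1" if "l \<in> S" for l
              using p01[OF that] d p[OF i(1)] p[OF j(1)] by (auto simp: move_def)
            show "sum (move d) S \<le> real k" "a = sum (move d) S / real (card S)"
              using le a by (simp_all add: move_sum)
          qed
          moreover have "d * (p j - p i - d) * C \<ge> 0"
            using d False by (intro mult_nonneg_nonneg) auto
          ultimately show ?thesis using move_drop[of d] by simp
        qed
      qed
    qed
  qed
  then show ?case by (simp add: drop_def G_def)
qed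

lemma poly_pderiv_prod_at_1:
  fixes f :: "'i \<Rightarrow> real poly"
  assumes "\<And>i. i \<in> S \<Longrightarrow> poly (f i) 1 = 1"
  shows "poly (pderiv (prod f S)) 1 = (\<Sum>i\<in>S. poly (pderiv (f i)) 1)"
  using assms by (simp add: pderiv_prod poly_sum poly_prod)

text \<open>
  Exchanging success and failure reverses the list of coefficients, which turns the claim into
  \<open>poisson_binomial_coeff_decreasing\<close>. Reversal at index \<open>card S\<close> is \<open>reflect_poly\<close> only because
  positive probabilities make the degree equal to \<open>card S\<close>.
\<close>

lemma poisson_binomial_coeff_increasing:
  fixes p :: "'i \<Rightarrow> real"
  assumes S: "finite S" and p: "\<And>i. i \<in> S \<Longrightarrow> 0 < p i \<and> p i \<le> 1"
    and k: "real (Suc k) \<le> sum p S"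
  shows "real (card S - k) * coeff (\<Prod>i\<in>S. [:1 - p i, p i:]) k \<le>
         real (card S - Suc k) * coeff (\<Prod>i\<in>S. [:1 - p i, p i:]) (Suc k)"
proof -
  define P where "P = (\<Prod>i\<in>S. [:1 - p i, p i:])"
  have le: "sum p S \<le> card S" using sum_bounded_above[of S p 1] p by simp
  then have kS: "Suc k \<le> card S" using k by linarith
  have deg: "degree P = card S"
    unfolding P_def using p by (subst degree_prod_eq_sum_degree) (auto simp: less_le)
  have rev: "reflect_poly P = (\<Prod>i\<in>S. [:1 - (1 - p i), 1 - p i:])"
    unfolding P_def reflect_poly_prod using p
    by (intro prod.cong) (auto simp: reflect_poly_def less_le cCons_def)
  define l where "l = card S - Suc k"
  have "real (Suc l) * coeff (reflect_poly P) (Suc l) \<le> real l * coeff (reflect_poly P) l"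
    unfolding rev
  proof (rule poisson_binomial_coeff_decreasing[OF S])
    show "0 \<le> 1 - p i \<and> 1 - p i \<le> 1" if "i \<in> S" for i using p[OF that] by auto
    show "(\<Sum>i\<in>S. 1 - p i) \<le> real l" using k kS by (simp add: sum_subtractf l_def of_nat_diff)
  qed
  moreover have "card S - Suc l = k" "card S - l = Suc k" "Suc l \<le> card S" "l \<le> card S"
    using kS by (auto simp: l_def)
  ultimately show ?thesis using kS
    by (simp add: coeff_reflect_poly deg flip: P_def) (simp add: l_def Suc_diff_Suc)
qed

section \<open>Polynomials with nonpositive roots\<close>

lemma poly_map_poly_of_real:
  "poly (map_poly complex_of_real P) (of_real x) = of_real (poly P x)"
  by (induction P rule: pCons_induct) (simp_all add: map_poly_pCons)

lemma map_poly_of_real_mult: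
  "map_poly complex_of_real (P * Q) = map_poly complex_of_real P * map_poly complex_of_real Q"
  by (rule poly_eqI) (simp add: coeff_mult coeff_map_poly)

definition nonpos_rooted :: "real poly \<Rightarrow> bool" where
  "nonpos_rooted P \<longleftrightarrow> P \<noteq> 0 \<and> (\<forall>z. poly (map_poly complex_of_real P) z = 0 \<longrightarrow> Im z = 0 \<and> Re z \<le> 0)"

text \<open>
  A linear factor \<open>y + r\<close> with \<open>r \<ge> 0\<close>, divided by its value at \<open>1\<close>, is the generating function of
  a Bernoulli variable with success probability \<open>1 / (1 + r)\<close>.
\<close>

lemma nonpos_rooted_factorization:
  assumes "nonpos_rooted P"
  shows "\<exists>n p. (\<forall>i<n. 0 < p i \<and> p i \<le> 1) \<and> P = smult (poly P 1) (\<Prod>i<n::nat. [:1 - p i, p i:])"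
  using assms
proof (induction "degree P" arbitrary: P)
  case 0
  then obtain c where "P = [:c:]" by (metis degree_0_id)
  then show ?case by (intro exI[of _ 0]) auto
next
  case (Suc d)
  have "degree (map_poly complex_of_real P) \<noteq> 0" using Suc.hyps(2) by (simp add: degree_map_poly)
  then obtain z where z: "poly (map_poly complex_of_real P) z = 0"
    using alg_closed_imp_poly_has_root by blast
  define r where "r = - Re z"
  have r: "r \<ge> 0" "z = of_real (-r)"
    using z Suc.prems by (auto simp: nonpos_rooted_def r_def complex_eq_iff)
  have "poly P (-r) = 0" using z poly_map_poly_of_real[of P "-r"] unfolding r(2) by simp
  then obtain R where R: "P = [:r, 1:] * R"
    by (metis dvdE minus_minus poly_eq_0_iff_dvd)
  have R0: "R \<noteq> 0" using Suc.prems R by (auto simp: nonpos_rooted_def)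
  have "nonpos_rooted R"
  proof -
    have "poly (map_poly complex_of_real P) w =
        poly (map_poly complex_of_real [:r, 1:]) w * poly (map_poly complex_of_real R) w" for w
      by (simp only: R map_poly_of_real_mult poly_mult)
    then show ?thesis using Suc.prems R0 by (auto simp: nonpos_rooted_def)
  qed
  moreover have "d = degree R" using Suc.hyps(2) R0 unfolding R by (subst (asm) degree_mult_eq) auto
  ultimately obtain n p where np: "\<forall>i<n. 0 < p i \<and> p i \<le> 1"
      "R = smult (poly R 1) (\<Prod>i<n::nat. [:1 - p i, p i:])"
    using Suc.hyps(1) by blast
  define q where "q = p(n := 1 / (1 + r))"
  have lin: "[:r, 1:] = smult (1 + r) [:1 - q n, q n:]"
    using r(1) by (simp add: q_def field_simps)
  have "(\<Prod>i<n. [:1 - q i, q i:]) = (\<Prod>i<n. [:1 - p i, p i:])"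
    by (intro prod.cong) (auto simp: q_def)
  then have "P = smult (1 + r) [:1 - q n, q n:] * smult (poly R 1) (\<Prod>i<n. [:1 - q i, q i:])"
    using R lin np(2) by metis
  also have "\<dots> = smult ((1 + r) * poly R 1) (\<Prod>i<Suc n. [:1 - q i, q i:])"
    by (simp only: mult_smult_left mult_smult_right smult_smult prod.lessThan_Suc mult.commute mult.left_commute)
  also have "(1 + r) * poly R 1 = poly P 1" by (simp add: R algebra_simps)
  finally have "P = smult (poly P 1) (\<Prod>i<Suc n. [:1 - q i, q i:])" .
  moreover have "\<forall>i<Suc n. 0 < q i \<and> q i \<le> 1" using np(1) r by (auto simp: q_def less_Suc_eq)
  ultimately show ?case by blast
qed

text \<open>
  Here \<open>poly (pderiv P) 1 / poly P 1\<close> is the mean. The factor \<open>c < 1\<close> makes the inequality strict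
  wherever the larger coefficient is positive, and still allows both coefficients to be \<open>0\<close>.
\<close>

lemma nonpos_rooted_mode:
  assumes P: "nonpos_rooted P" "0 < poly P 1"
  shows "poly (pderiv P) 1 \<le> real k * poly P 1 \<Longrightarrow>
           \<exists>c. 0 \<le> c \<and> c < 1 \<and> coeff P (Suc k) \<le> c * coeff P k"
    and "real (Suc k) * poly P 1 \<le> poly (pderiv P) 1 \<Longrightarrow>
           \<exists>c. 0 \<le> c \<and> c < 1 \<and> coeff P k \<le> c * coeff P (Suc k)"
proof -
  obtain n p where p: "\<forall>i<n. 0 < p i \<and> p i \<le> 1"
    and eq: "P = smult (poly P 1) (\<Prod>i<n::nat. [:1 - p i, p i:])"
    using nonpos_rooted_factorization[OF P(1)] by blast
  define B where "B = (\<Prod>i<n. [:1 - p i, p i:])"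
  have cP: "coeff P j = poly P 1 * coeff B j" for j
    by (subst eq) (simp add: B_def)
  have "poly (pderiv B) 1 = sum p {..<n}"
    unfolding B_def by (subst poly_pderiv_prod_at_1) (auto simp: pderiv_pCons)
  moreover have "poly (pderiv P) 1 = poly P 1 * poly (pderiv B) 1"
    by (subst eq) (simp add: B_def pderiv_smult)
  ultimately have mean: "poly (pderiv P) 1 = poly P 1 * sum p {..<n}" by simp
  show "\<exists>c. 0 \<le> c \<and> c < 1 \<and> coeff P (Suc k) \<le> c * coeff P k"
    if "poly (pderiv P) 1 \<le> real k * poly P 1"
  proof (intro exI conjI)
    have "sum p {..<n} \<le> real k" using that P(2) by (simp add: mean mult.commute)
    then have "real (Suc k) * coeff B (Suc k) \<le> real k * coeff B k"
      unfolding B_def by (intro poisson_binomial_coeff_decreasing) (use p in auto)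
    then have "coeff B (Suc k) \<le> real k / real (Suc k) * coeff B k"
      by (simp add: field_simps)
    then show "coeff P (Suc k) \<le> real k / real (Suc k) * coeff P k"
      using mult_left_mono[of _ _ "poly P 1"] P(2) by (fastforce simp: cP mult.left_commute)
  qed auto
  show "\<exists>c. 0 \<le> c \<and> c < 1 \<and> coeff P k \<le> c * coeff P (Suc k)"
    if "real (Suc k) * poly P 1 \<le> poly (pderiv P) 1"
  proof (intro exI conjI)
    have k: "real (Suc k) \<le> sum p {..<n}" using that P(2) by (simp add: mean mult.commute)
    have "sum p {..<n} \<le> n" using sum_bounded_above[of "{..<n}" p 1] p by simp
    then have kn: "Suc k \<le> n" using k by linarith
    have "real (n - k) * coeff B k \<le> real (n - Suc k) * coeff B (Suc k)"
      using poisson_binomial_coeff_increasing[of "{..<n}" p k] p k by (simp add: B_def)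
    then have "coeff B k \<le> real (n - Suc k) / real (n - k) * coeff B (Suc k)"
      using kn by (simp add: field_simps)
    then show "coeff P k \<le> real (n - Suc k) / real (n - k) * coeff P (Suc k)"
      using mult_left_mono[of _ _ "poly P 1"] P(2) by (fastforce simp: cP mult.left_commute)
    show "real (n - Suc k) / real (n - k) < 1" using kn by (simp add: divide_simps)
  qed auto
qed

section \<open>The Hermite-Biehler argument\<close>

definition even_part :: "'a :: comm_ring_1 poly \<Rightarrow> 'a poly" where
  "even_part F = (\<Sum>k\<le>degree F. monom (coeff F (2 * k)) k)"

definition odd_part :: "'a :: comm_ring_1 poly \<Rightarrow> 'a poly" where
  "odd_part F = (\<Sum>k\<le>degree F. monom (coeff F (2 * k + 1)) k)"

lemma coeff_even_part [simp]: "coeff (even_part F) k = coeff F (2 * k)"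
  by (cases "k \<le> degree F") (auto simp: even_part_def coeff_sum coeff_eq_0)

lemma coeff_odd_part [simp]: "coeff (odd_part F) k = coeff F (2 * k + 1)"
  by (cases "k \<le> degree F") (auto simp: odd_part_def coeff_sum coeff_eq_0)

text \<open>
  Multiplication by \<open>z\<close> exchanges the two parts up to a shift, so an induction over the coefficients
  works without any reindexing of sums.
\<close>

lemma parity_decomposition:
  "F = pcompose (even_part F) [:0, 0, 1:] + [:0, 1:] * pcompose (odd_part F) [:0, 0, 1:]"
proof (induction F rule: pCons_induct)
  case 0
  have "even_part (0 :: 'a poly) = 0" "odd_part (0 :: 'a poly) = 0" by (auto simp: poly_eq_iff)
  then show ?case by simp
next
  case (pCons a F)
  have "even_part (pCons a F) = pCons a (odd_part F)" "odd_part (pCons a F) = even_part F"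
    by (auto simp: poly_eq_iff coeff_pCons split: nat.splits)
  then show ?case using pCons.IH
    by (simp add: pcompose_pCons algebra_simps)
qed

lemma map_poly_parity:
  "map_poly complex_of_real (even_part F) = even_part (map_poly complex_of_real F)"
  "map_poly complex_of_real (odd_part F) = odd_part (map_poly complex_of_real F)"
  by (auto simp: poly_eq_iff coeff_map_poly)

text \<open>
  For real \<open>F\<close> this holds whenever all roots lie in the open left half plane and there is at least
  one. Expressed through absolute values it passes to products at once.
\<close>

definition right_dominant :: "complex poly \<Rightarrow> bool" where
  "right_dominant F \<longleftrightarrow> (\<forall>z. 0 < Re z \<longrightarrow> cmod (poly F (- z)) < cmod (poly F z))"

lemma right_dominant_mult:
  assumes "right_dominant F" "right_dominant G"
  shows "right_dominant (F * G)"
  using assms unfolding right_dominant_def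
  by (auto simp: norm_mult intro!: mult_strict_mono')

lemma cmod_diff_less_cmod_add:
  assumes "0 < Re (a * cnj b)"
  shows "cmod (a - b) < cmod (a + b)"
proof (rule power2_less_imp_less)
  show "(cmod (a - b))\<^sup>2 < (cmod (a + b))\<^sup>2"
    using assms unfolding cmod_power2 by (simp add: power2_eq_square algebra_simps)
qed auto

text \<open>
  If \<open>z\<^sup>2\<close> is a root of the even or of the odd part, then \<open>F(-z)\<close> is \<open>F(z)\<close> or \<open>- F(z)\<close>, so
  dominance excludes that \<open>z\<close> has positive real part. The square root \<open>z\<close> with nonnegative real
  part is then purely imaginary, so \<open>z\<^sup>2\<close> is real and nonpositive.
\<close>

lemma nonpos_rooted_parity:
  assumes F: "right_dominant (map_poly complex_of_real F)"
  shows "nonpos_rooted (even_part F)" "nonpos_rooted (odd_part F)"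
proof -
  define G where "G = map_poly complex_of_real F"
  have G: "poly G z = poly (even_part G) (z\<^sup>2) + z * poly (odd_part G) (z\<^sup>2)" for z
    by (subst parity_decomposition[of G]) (simp add: poly_pcompose power2_eq_square)
  have roots: "Im y = 0 \<and> Re y \<le> 0"
    if y: "poly (even_part G) y = 0 \<or> poly (odd_part G) y = 0" for y
  proof -
    define z where "z = csqrt y"
    have y': "y = z\<^sup>2" by (simp add: z_def)
    have "cmod (poly G (- z)) = cmod (poly G z)"
      using y G[of z] G[of "-z"] by (auto simp: y')
    then have "\<not> 0 < Re z" using F unfolding right_dominant_def G_def by (metis less_irrefl)
    then have "Re z = 0" using csqrt_principal[of y] by (auto simp: z_def)
    then show ?thesis by (simp add: y' power2_eq_square)
  qed
  have "even_part G \<noteq> 0" "odd_part G \<noteq> 0" using roots[of 1] by auto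
  with roots show "nonpos_rooted (even_part F)" "nonpos_rooted (odd_part F)"
    unfolding nonpos_rooted_def G_def by (auto simp: map_poly_parity[symmetric])
qed

text \<open>
  If \<open>R\<close> generates the distribution of a variable with mean \<open>m\<close>, then \<open>U / 2\<close> belongs to the sum of
  it and a fair coin, whose parity is again fair. Hence conditioning on either parity moves the mean
  \<open>m + 1 / 2\<close> by only \<open>\<bar>poly R (-1)\<bar> / 2 \<le> 1 / 2\<close>, and \<open>nonpos_rooted_mode\<close> applies to each parity
  class.
\<close>

lemma smoothed_coeff_mode:
  fixes R :: "real poly"
  defines "U \<equiv> [:1, 1:] * R" and "m \<equiv> poly (pderiv R) 1"
  assumes dom: "right_dominant (map_poly complex_of_real U)"
    and R: "poly R 1 = 1" "\<bar>poly R (-1)\<bar> \<le> 1"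
  shows "m + 1 \<le> real j \<Longrightarrow> \<exists>c. 0 \<le> c \<and> c < 1 \<and> coeff U (j + 2) \<le> c * coeff U j"
    and "real j + 2 \<le> m \<Longrightarrow> \<exists>c. 0 \<le> c \<and> c < 1 \<and> coeff U j \<le> c * coeff U (j + 2)"
proof -
  note roots = nonpos_rooted_parity[OF dom]
  define E D where "E = even_part U" and "D = odd_part U"
  have U: "U = pcompose E [:0, 0, 1:] + [:0, 1:] * pcompose D [:0, 0, 1:]"
    unfolding E_def D_def by (rule parity_decomposition)
  have "poly U 1 = poly E 1 + poly D 1" "poly U (-1) = poly E 1 - poly D 1"
    by (simp_all add: U poly_pcompose)
  moreover have "poly U 1 = 2" "poly U (-1) = 0" using R by (simp_all add: U_def)
  ultimately have ED: "poly E 1 = 1" "poly D 1 = 1" by auto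
  have "poly (pderiv U) z = poly (pderiv E) (z\<^sup>2) * (2 * z) + poly D (z\<^sup>2) + z * (poly (pderiv D) (z\<^sup>2) * (2 * z))" for z
    by (simp add: U pderiv_add pderiv_mult pderiv_pcompose poly_pcompose pderiv_pCons power2_eq_square algebra_simps)
  \<comment> \<open>The values of \<open>U'\<close> at \<open>1\<close> and \<open>-1\<close> determine the means of both parts.\<close>
  from this[of 1] this[of "-1"]
  have "poly (pderiv U) 1 = 2 * poly (pderiv E) 1 + 1 + 2 * poly (pderiv D) 1"
     "poly (pderiv U) (-1) = - 2 * poly (pderiv E) 1 + 1 + 2 * poly (pderiv D) 1"
    using ED by auto
  moreover have "poly (pderiv U) 1 = 1 + 2 * m" "poly (pderiv U) (-1) = poly R (-1)"
    using R(1) by (simp_all add: U_def m_def pderiv_mult pderiv_pCons pderiv_add)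
  ultimately have E': "2 * poly (pderiv E) 1 = m + 1 / 2 - poly R (-1) / 2"
    and D': "2 * poly (pderiv D) 1 + 1 = m + 1 / 2 + poly R (-1) / 2" by (auto simp: field_simps)
  note mE = nonpos_rooted_mode[OF roots(1), folded E_def, unfolded ED, simplified, unfolded E_def, simplified]
  note mD = nonpos_rooted_mode[OF roots(2), folded D_def, unfolded ED, simplified, unfolded D_def, simplified]
  show "\<exists>c. 0 \<le> c \<and> c < 1 \<and> coeff U (j + 2) \<le> c * coeff U j" if j: "m + 1 \<le> real j"
  proof (cases "even j")
    case True
    then obtain k where k: "j = 2 * k" by (elim evenE)
    have "poly (pderiv E) 1 \<le> real k" using j E' R(2) unfolding k by simp
    from mE(1)[OF this[unfolded E_def]] show ?thesis by (simp add: k)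
  next
    case False
    then obtain k where k: "j = 2 * k + 1" by (elim oddE)
    have "poly (pderiv D) 1 \<le> real k" using j D' R(2) unfolding k by simp
    from mD(1)[OF this[unfolded D_def]] show ?thesis by (simp add: k)
  qed
  show "\<exists>c. 0 \<le> c \<and> c < 1 \<and> coeff U j \<le> c * coeff U (j + 2)" if j: "real j + 2 \<le> m"
  proof (cases "even j")
    case True
    then obtain k where k: "j = 2 * k" by (elim evenE)
    have "1 + real k \<le> poly (pderiv E) 1" using j E' R(2) unfolding k by simp
    from mE(2)[OF this[unfolded E_def]] show ?thesis by (simp add: k)
  next
    case False
    then obtain k where k: "j = 2 * k + 1" by (elim oddE)
    have "1 + real k \<le> poly (pderiv D) 1" using j D' R(2) unfolding k by simp
    from mD(2)[OF this[unfolded D_def]] show ?thesis by (simp add: k)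
  qed
qed

section \<open>Generating functions of matches\<close>

text \<open>
  The generating function of twice the points of team B in one match, where \<open>x\<close> is \<open>\<alpha>\<close> times the
  strength differential. Doubling makes all exponents integral.
\<close>

definition match_gf :: "real \<Rightarrow> real \<Rightarrow> real poly" where
  "match_gf \<beta> x = [:\<beta> - x, 1 - 2 * \<beta>, \<beta> + x:]"

text \<open>
  The left-hand side depends on the offsets only through their sum and their product; this is what
  makes the effect of an exchange of opponents explicit.
\<close>

lemma match_gf_mult:
  "match_gf \<beta> x * match_gf \<beta> y =
     match_gf \<beta> 0 * match_gf \<beta> (x + y) + smult (x * y) ([:-1, 0, 1:]\<^sup>2)"
  by (simp add: match_gf_def power2_eq_square algebra_simps)

text \<open>
  Split the value at \<open>z\<close> into its parts \<open>a\<close> and \<open>b\<close> of even and odd degree. Dominance of \<open>a + b\<close> over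
  \<open>a - b\<close> means that \<open>a\<close> and \<open>b\<close> enclose an acute angle, which holds because all coefficients are
  positive.
\<close>

lemma right_dominant_match_gf:
  assumes "0 < \<beta>" "\<beta> < 1 / 2" "\<bar>x\<bar> < \<beta>"
  shows "right_dominant (map_poly complex_of_real (match_gf \<beta> x))"
  unfolding right_dominant_def
proof safe
  fix z :: complex assume z: "0 < Re z"
  define a b where "a = of_real (\<beta> - x) + of_real (\<beta> + x) * z\<^sup>2" and "b = of_real (1 - 2 * \<beta>) * z"
  have "a * cnj b = of_real (1 - 2 * \<beta>) * (of_real (\<beta> - x) * cnj z + of_real (\<beta> + x) * (z * cnj z) * z)"
    by (simp add: a_def b_def power2_eq_square algebra_simps)
  then have "Re (a * cnj b) = (1 - 2 * \<beta>) * ((\<beta> - x) * Re z + (\<beta> + x) * (cmod z)\<^sup>2 * Re z)"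
    by (simp only: complex_norm_square[symmetric]) (simp add: Re_complex_of_real algebra_simps)
  also have "\<dots> > 0"
    using assms z by (intro mult_pos_pos add_pos_nonneg mult_nonneg_nonneg) auto
  finally have "cmod (a - b) < cmod (a + b)" by (rule cmod_diff_less_cmod_add)
  moreover have "poly (map_poly complex_of_real (match_gf \<beta> x)) z = a + b"
    "poly (map_poly complex_of_real (match_gf \<beta> x)) (- z) = a - b"
    by (simp_all add: match_gf_def map_poly_pCons a_def b_def power2_eq_square algebra_simps)
  ultimately show "cmod (poly (map_poly complex_of_real (match_gf \<beta> x)) (- z)) <
      cmod (poly (map_poly complex_of_real (match_gf \<beta> x)) z)" by simp
qed

lemma coeff_prod_match_gf_pos:
  assumes "finite S" "0 < \<beta>" "\<beta> < 1 / 2" "\<And>i. i \<in> S \<Longrightarrow> \<bar>x i\<bar> < \<beta>" "k \<le> 2 * card S"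
  shows "0 < coeff (\<Prod>i\<in>S. match_gf \<beta> (x i)) k"
  using assms(1,4,5)
proof (induction S arbitrary: k rule: finite_induct)
  case (insert i S)
  define P where "P = (\<Prod>i\<in>S. match_gf \<beta> (x i))"
  have nn: "0 \<le> coeff P j" for j unfolding P_def
    by (rule coeff_prod_nonneg) (use insert.prems assms(2,3) in \<open>force simp: match_gf_def coeff_pCons abs_less_iff split: nat.splits\<close>)
  have pos: "0 < coeff P j" if "j \<le> 2 * card S" for j
    using insert that by (auto simp: P_def)
  have xi: "0 < \<beta> - x i" "0 < \<beta> + x i" using insert.prems(1)[of i] by auto
  have "k = 0 \<or> k = 1 \<or> (\<exists>j. k = Suc (Suc j) \<and> j \<le> 2 * card S)" using insert by (cases k; cases "k - 1") auto
  then show ?case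
  proof (elim disjE exE conjE)
    assume "k = 0"
    then show ?thesis using insert.hyps pos[of 0] xi by (simp add: match_gf_def P_def[unfolded match_gf_def, symmetric])
  next
    assume "k = 1"
    then show ?thesis using insert.hyps pos[of 0] nn[of 1] xi assms
      by (auto simp: match_gf_def simp add: P_def[unfolded match_gf_def, symmetric] intro!: add_nonneg_pos)
  next
    fix j assume "k = Suc (Suc j)" "j \<le> 2 * card S"
    then show ?thesis using insert.hyps pos[of j] nn[of "Suc j"] nn[of "Suc (Suc j)"] xi assms
      by (auto simp: match_gf_def simp add: P_def[unfolded match_gf_def, symmetric] intro!: add_nonneg_pos)
  qed
qed auto

text \<open>
  Each match has mean \<open>1 + 2 x\<close> and the value \<open>4 \<beta> - 1\<close> at \<open>-1\<close>, which is at most \<open>1\<close> in absolute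
  value for \<open>0 < \<beta> < 1 / 2\<close>, as \<open>smoothed_coeff_mode\<close> demands of the product.
\<close>

lemma match_product_mode:
  fixes x :: "'i \<Rightarrow> real"
  assumes S: "finite S" and \<beta>: "0 < \<beta>" "\<beta> < 1 / 2" and x: "\<And>i. i \<in> S \<Longrightarrow> \<bar>x i\<bar> < \<beta>"
  defines "U \<equiv> [:1, 1:] * (\<Prod>i\<in>S. match_gf \<beta> (x i))" and "m \<equiv> card S + 2 * sum x S"
  shows "m + 1 \<le> real j \<Longrightarrow> \<exists>c. 0 \<le> c \<and> c < 1 \<and> coeff U (j + 2) \<le> c * coeff U j"
    and "real j + 2 \<le> m \<Longrightarrow> \<exists>c. 0 \<le> c \<and> c < 1 \<and> coeff U j \<le> c * coeff U (j + 2)"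
proof -
  define R where "R = (\<Prod>i\<in>S. match_gf \<beta> (x i))"
  have at1: "poly (match_gf \<beta> y) 1 = 1" for y by (simp add: match_gf_def)
  have "poly (pderiv R) 1 = (\<Sum>i\<in>S. 1 + 2 * x i)"
    unfolding R_def by (subst poly_pderiv_prod_at_1) (simp_all add: at1, simp add: match_gf_def pderiv_pCons)
  then have m: "m = poly (pderiv R) 1" by (simp add: m_def sum.distrib sum_distrib_left)
  have "poly R (-1) = (4 * \<beta> - 1) ^ card S"
    unfolding R_def poly_prod by (simp add: match_gf_def)
  then have "\<bar>poly R (-1)\<bar> \<le> 1" using \<beta> by (simp add: power_abs power_le_one)
  moreover have "poly R 1 = 1" by (simp add: R_def poly_prod at1)
  moreover have "right_dominant (map_poly complex_of_real ([:1, 1:] * R))"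
    unfolding R_def using S x
  proof (induction S rule: finite_induct)
    case empty
    show ?case
      using cmod_diff_less_cmod_add[of 1] by (auto simp: right_dominant_def map_poly_pCons)
  next
    case (insert i S)
    \<comment> \<open>The factor \<open>1 + z\<close> is kept throughout: the empty product \<open>1\<close> alone is not strictly dominant.\<close>
    have "[:1, 1:] * (\<Prod>i\<in>insert i S. match_gf \<beta> (x i)) =
        match_gf \<beta> (x i) * ([:1, 1:] * (\<Prod>i\<in>S. match_gf \<beta> (x i)))"
      unfolding prod.insert[OF insert.hyps] by (rule mult.left_commute)
    with insert show ?case
      by (simp only: map_poly_of_real_mult right_dominant_mult right_dominant_match_gf \<beta> insertI1 insertI2)
  qed
  ultimately show "m + 1 \<le> real j \<Longrightarrow> \<exists>c. 0 \<le> c \<and> c < 1 \<and> coeff U (j + 2) \<le> c * coeff U j"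
    and "real j + 2 \<le> m \<Longrightarrow> \<exists>c. 0 \<le> c \<and> c < 1 \<and> coeff U j \<le> c * coeff U (j + 2)"
    unfolding U_def m R_def[symmetric] using smoothed_coeff_mode[of R] by auto
qed

section \<open>The distribution of the total score\<close>

lemma (in prob_space) finite_valued_integral:
  fixes Y :: "'a \<Rightarrow> real" and \<phi> :: "real \<Rightarrow> real"
  assumes V: "finite V" "\<And>\<omega>. \<omega> \<in> space M \<Longrightarrow> Y \<omega> \<in> V" and [measurable]: "random_variable borel Y"
  shows "integrable M (\<lambda>\<omega>. \<phi> (Y \<omega>))"
    and "expectation (\<lambda>\<omega>. \<phi> (Y \<omega>)) = (\<Sum>v\<in>V. \<phi> v * prob {\<omega> \<in> space M. Y \<omega> = v})"
proof -
  define A where "A v = {\<omega> \<in> space M. Y \<omega> = v}" for v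
  have [measurable]: "A v \<in> events" for v unfolding A_def by measurable
  have eq: "\<phi> (Y \<omega>) = (\<Sum>v\<in>V. \<phi> v * indicator (A v) \<omega>)" if "\<omega> \<in> space M" for \<omega>
    using V that by (simp add: A_def indicator_def sum.delta if_distrib cong: if_cong)
  have "integrable M (\<lambda>\<omega>. \<phi> (Y \<omega>)) = integrable M (\<lambda>\<omega>. \<Sum>v\<in>V. \<phi> v * indicator (A v) \<omega>)"
    by (rule Bochner_Integration.integrable_cong) (auto simp: eq)
  also have "\<dots>" by (auto simp: emeasure_eq_measure)
  finally show "integrable M (\<lambda>\<omega>. \<phi> (Y \<omega>))" .
  have "expectation (\<lambda>\<omega>. \<phi> (Y \<omega>)) = expectation (\<lambda>\<omega>. \<Sum>v\<in>V. \<phi> v * indicator (A v) \<omega>)"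
    by (rule Bochner_Integration.integral_cong) (auto simp: eq)
  also have "\<dots> = (\<Sum>v\<in>V. \<phi> v * prob (A v))"
    by (subst Bochner_Integration.integral_sum) (auto simp: emeasure_eq_measure)
  finally show "expectation (\<lambda>\<omega>. \<phi> (Y \<omega>)) = (\<Sum>v\<in>V. \<phi> v * prob {\<omega> \<in> space M. Y \<omega> = v})"
    by (simp add: A_def)
qed

text \<open>
  For a generating function \<open>P\<close> this is the probability of values of at least \<open>K\<close>. Subtracting an
  initial sum avoids any reference to the degree.
\<close>

definition upper_tail :: "nat \<Rightarrow> real poly \<Rightarrow> real" where
  "upper_tail K P = 1 - (\<Sum>j<K. coeff P j)"

text \<open>
  For every real \<open>z\<close>, independence factorizes the expectation of \<open>z\<close> to the power of twice the score.
  Two polynomials that agree at all reals have the same coefficients, and these are the point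
  probabilities.
\<close>

lemma (in prob_space) prob_score_ge:
  fixes Y :: "'i \<Rightarrow> 'a \<Rightarrow> real"
  assumes I: "finite I" and indep: "indep_vars (\<lambda>_. borel) Y I"
    and val: "\<And>i \<omega>. i \<in> I \<Longrightarrow> \<omega> \<in> space M \<Longrightarrow> Y i \<omega> \<in> {0, 1 / 2, 1}"
    and win: "\<And>i. i \<in> I \<Longrightarrow> prob {\<omega> \<in> space M. Y i \<omega> = 1} = \<beta> + x i"
    and loss: "\<And>i. i \<in> I \<Longrightarrow> prob {\<omega> \<in> space M. Y i \<omega> = 0} = \<beta> - x i"
    and tie: "\<And>i. i \<in> I \<Longrightarrow> prob {\<omega> \<in> space M. Y i \<omega> = 1 / 2} = 1 - 2 * \<beta>"
  shows "prob {\<omega> \<in> space M. real K / 2 \<le> (\<Sum>i\<in>I. Y i \<omega>)} = upper_tail K (\<Prod>i\<in>I. match_gf \<beta> (x i))"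
proof -
  have rv [measurable]: "\<And>i. i \<in> I \<Longrightarrow> random_variable borel (Y i)"
    using indep by (auto simp: indep_vars_def)
  define T where "T \<omega> = (\<Sum>i\<in>I. Y i \<omega>)" for \<omega>
  have T [measurable]: "random_variable borel T" unfolding T_def by measurable
  define A where "A j = {\<omega> \<in> space M. T \<omega> = real j / 2}" for j
  have A [measurable]: "A j \<in> events" for j unfolding A_def by measurable
  \<comment> \<open>On the possible scores, \<open>h\<close> is doubling with values in the natural numbers.\<close>
  define h where "h y = nat \<lfloor>2 * y\<rfloor>" for y :: real
  have h: "real (h y) = 2 * y" if "y \<in> {0, 1 / 2, 1}" for y
  proof -
    have "\<exists>m. 2 * y = real m"
      using that by (elim insertE) (auto intro: exI[of _ 0] exI[of _ 1] exI[of _ 2])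
    then show ?thesis by (auto simp: h_def)
  qed
  have T2: "2 * T \<omega> = real (\<Sum>i\<in>I. h (Y i \<omega>))" if "\<omega> \<in> space M" for \<omega>
    using h[OF val] that by (simp add: T_def sum_distrib_left)
  have hT: "h (T \<omega>) = (\<Sum>i\<in>I. h (Y i \<omega>))" if "\<omega> \<in> space M" for \<omega>
    unfolding h_def[of "T \<omega>"] T2[OF that] by (simp del: of_nat_sum)
  define V where "V = (\<lambda>j. real j / 2) ` {..2 * card I}"
  have TV: "T \<omega> \<in> V" if \<omega>: "\<omega> \<in> space M" for \<omega>
  proof -
    have "(\<Sum>i\<in>I. h (Y i \<omega>)) \<le> (\<Sum>i\<in>I. 2)"
      by (rule sum_mono) (use h[OF val[OF _ \<omega>]] val[OF _ \<omega>] in force)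
    then show ?thesis using T2[OF \<omega>] unfolding V_def
      by (intro image_eqI[of _ _ "\<Sum>i\<in>I. h (Y i \<omega>)"]) auto
  qed
  define B where "B = (\<Sum>j\<le>2 * card I. monom (prob (A j)) j)"
  have "poly B z = poly (\<Prod>i\<in>I. match_gf \<beta> (x i)) z" for z
  proof -
    define \<phi> where "\<phi> y = z ^ h y" for y
    have [measurable]: "\<phi> \<in> borel_measurable borel" unfolding \<phi>_def h_def by measurable
    have "(\<Sum>v\<in>V. \<phi> v * prob {\<omega> \<in> space M. T \<omega> = v}) = poly B z"
      unfolding V_def by (subst sum.reindex)
        (auto simp: inj_on_def B_def poly_sum poly_monom \<phi>_def h_def A_def intro!: sum.cong)
    then have "poly B z = expectation (\<lambda>\<omega>. \<phi> (T \<omega>))"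
      using finite_valued_integral(2)[of V T \<phi>] TV by (simp add: V_def)
    also have "\<dots> = expectation (\<lambda>\<omega>. \<Prod>i\<in>I. \<phi> (Y i \<omega>))"
      by (rule Bochner_Integration.integral_cong) (auto simp: \<phi>_def hT power_sum)
    also have "\<dots> = (\<Prod>i\<in>I. expectation (\<lambda>\<omega>. \<phi> (Y i \<omega>)))"
    proof (rule indep_vars_lebesgue_integral[OF I])
      show "indep_vars (\<lambda>_. borel) (\<lambda>i \<omega>. \<phi> (Y i \<omega>)) I"
        by (rule indep_vars_compose2[OF indep]) simp
      show "integrable M (\<lambda>\<omega>. \<phi> (Y i \<omega>))" if "i \<in> I" for i
        by (rule finite_valued_integral(1)[of "{0, 1 / 2, 1}"]) (use that val in auto)
    qed
    also have "\<dots> = (\<Prod>i\<in>I. poly (match_gf \<beta> (x i)) z)"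
    proof (rule prod.cong[OF refl])
      fix i assume i: "i \<in> I"
      have "expectation (\<lambda>\<omega>. \<phi> (Y i \<omega>)) = (\<Sum>v\<in>{0, 1 / 2, 1}. \<phi> v * prob {\<omega> \<in> space M. Y i \<omega> = v})"
        by (rule finite_valued_integral(2)) (use i val in auto)
      also have "\<dots> = \<phi> 0 * prob {\<omega> \<in> space M. Y i \<omega> = 0} +
          (\<phi> (1 / 2) * prob {\<omega> \<in> space M. Y i \<omega> = 1 / 2} + \<phi> 1 * prob {\<omega> \<in> space M. Y i \<omega> = 1})"
        by simp
      also have "\<dots> = \<phi> 0 * (\<beta> - x i) + (\<phi> (1 / 2) * (1 - 2 * \<beta>) + \<phi> 1 * (\<beta> + x i))"
        by (simp only: win loss tie i)
      also have "\<dots> = poly (match_gf \<beta> (x i)) z"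
        by (simp add: match_gf_def \<phi>_def h_def power2_eq_square algebra_simps)
      finally show "expectation (\<lambda>\<omega>. \<phi> (Y i \<omega>)) = poly (match_gf \<beta> (x i)) z" .
    qed
    finally show ?thesis by (simp add: poly_prod)
  qed
  then have B: "B = (\<Prod>i\<in>I. match_gf \<beta> (x i))" by (simp add: poly_eq_poly_eq_iff[symmetric] fun_eq_iff)
  have coeffB: "coeff B j = prob (A j)" for j
  proof (cases "j \<le> 2 * card I")
    case True
    then show ?thesis by (simp add: B_def coeff_sum)
  next
    case False
    then have "A j = {}" using TV by (force simp: A_def V_def)
    with False show ?thesis by (simp add: B_def coeff_sum)
  qed
  have un: "{\<omega> \<in> space M. \<not> real K / 2 \<le> T \<omega>} = (\<Union>j<K. A j)"
  proof (intro set_eqI iffI)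
    fix \<omega> assume \<omega>: "\<omega> \<in> {\<omega> \<in> space M. \<not> real K / 2 \<le> T \<omega>}"
    then obtain j where "T \<omega> = real j / 2" using TV[of \<omega>] by (auto simp: V_def)
    with \<omega> show "\<omega> \<in> (\<Union>j<K. A j)" by (auto simp: A_def intro!: bexI[of _ j])
  qed (auto simp: A_def)
  have "prob {\<omega> \<in> space M. real K / 2 \<le> T \<omega>} = 1 - prob {\<omega> \<in> space M. \<not> real K / 2 \<le> T \<omega>}"
    by (subst prob_neg) auto
  also have "prob {\<omega> \<in> space M. \<not> real K / 2 \<le> T \<omega>} = (\<Sum>j<K. prob (A j))"
    unfolding un by (rule finite_measure_finite_Union) (auto simp: A_def disjoint_family_on_def)
  finally show ?thesis by (simp add: T_def upper_tail_def coeffB flip: B)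
qed

section \<open>Exchanging two opponents\<close>

text \<open>
  The two products differ by a multiple of \<open>(z\<^sup>2 - 1)\<^sup>2 R = (z - 1) V\<close>, and the partial sums of the
  coefficients of \<open>(z - 1) V\<close> telescope to \<open>- V\<^sub>l\<close>. Extracting only one factor \<open>z - 1\<close> leaves
  \<open>1 + z\<close> in \<open>V\<close>, which is the fair coin of \<open>smoothed_coeff_mode\<close>.
\<close>

lemma upper_tail_swap_factors:
  fixes x y x' y' :: real
  assumes "x + y = x' + y'"
  shows "upper_tail (Suc l) (match_gf \<beta> x' * match_gf \<beta> y' * R) -
           upper_tail (Suc l) (match_gf \<beta> x * match_gf \<beta> y * R) =
         (x' * y' - x * y) * coeff ([:-1, 0, 1:] * ([:1, 1:] * R)) l"
proof -
  define V where "V = [:-1, 0, 1:] * ([:1, 1:] * R)"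
  have sq: "[:-1, 0, 1:]\<^sup>2 * R = [:-1, 1:] * V"
  proof -
    have "[:-1, 0, 1:]\<^sup>2 = [:-1, 1:] * ([:-1, 0, 1:] * [:1, 1 :: real:])" by (simp add: power2_eq_square)
    then show ?thesis unfolding V_def by (simp only: mult.assoc)
  qed
  have "match_gf \<beta> x' * match_gf \<beta> y' - match_gf \<beta> x * match_gf \<beta> y =
      smult (x' * y' - x * y) ([:-1, 0, 1:]\<^sup>2)"
    unfolding match_gf_mult[of \<beta> x y] match_gf_mult[of \<beta> x' y'] assms by (simp add: smult_diff_left)
  then have "match_gf \<beta> x' * match_gf \<beta> y' * R - match_gf \<beta> x * match_gf \<beta> y * R =
      smult (x' * y' - x * y) ([:-1, 1:] * V)"
    by (simp only: sq[symmetric] left_diff_distrib[symmetric] mult_smult_left)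
  moreover have "(\<Sum>j<Suc l. coeff ([:-1, 1:] * V) j) = - coeff V l"
    by (induction l) (simp_all add: algebra_simps)
  moreover have "upper_tail (Suc l) P - upper_tail (Suc l) Q = - (\<Sum>j<Suc l. coeff (P - Q) j)" for P Q
    by (simp add: upper_tail_def sum_subtractf)
  ultimately show ?thesis
    by (simp only: coeff_smult sum_distrib_left[symmetric] V_def[symmetric] minus_mult_right minus_minus)
qed

definition ordering_gf :: "real \<Rightarrow> real \<Rightarrow> nat \<Rightarrow> (nat \<Rightarrow> real) \<Rightarrow> (nat \<Rightarrow> real) \<Rightarrow> (nat \<Rightarrow> nat) \<Rightarrow> real poly" where
  "ordering_gf \<alpha> \<beta> n a b \<sigma> = (\<Prod>i = 1..n. match_gf \<beta> (\<alpha> * (b (\<sigma> i) - a i)))"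

lemma upper_tail_swap_players:
  fixes a b :: "nat \<Rightarrow> real"
  assumes ij: "i \<in> {1..n}" "j \<in> {1..n}" "i \<noteq> j"
  shows "upper_tail (Suc l) (ordering_gf \<alpha> \<beta> n a b (\<sigma> \<circ> Transposition.transpose i j)) -
           upper_tail (Suc l) (ordering_gf \<alpha> \<beta> n a b \<sigma>) =
         \<alpha>\<^sup>2 * (a i - a j) * (b (\<sigma> j) - b (\<sigma> i)) *
           coeff ([:-1, 0, 1:] * ([:1, 1:] * (\<Prod>r\<in>{1..n} - {i} - {j}. match_gf \<beta> (\<alpha> * (b (\<sigma> r) - a r))))) l"
proof -
  define R where "R = (\<Prod>r\<in>{1..n} - {i} - {j}. match_gf \<beta> (\<alpha> * (b (\<sigma> r) - a r)))"
  have split: "ordering_gf \<alpha> \<beta> n a b \<tau> = match_gf \<beta> (\<alpha> * (b (\<tau> i) - a i)) * match_gf \<beta> (\<alpha> * (b (\<tau> j) - a j)) * R"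
    if "\<And>r. r \<noteq> i \<Longrightarrow> r \<noteq> j \<Longrightarrow> \<tau> r = \<sigma> r" for \<tau>
  proof -
    have "ordering_gf \<alpha> \<beta> n a b \<tau> = match_gf \<beta> (\<alpha> * (b (\<tau> i) - a i)) * (match_gf \<beta> (\<alpha> * (b (\<tau> j) - a j)) *
        (\<Prod>r\<in>{1..n} - {i} - {j}. match_gf \<beta> (\<alpha> * (b (\<tau> r) - a r))))"
      unfolding ordering_gf_def using ij
      by (subst prod.remove[of _ i], simp, simp, subst prod.remove[of "{1..n} - {i}" j]) auto
    also have "(\<Prod>r\<in>{1..n} - {i} - {j}. match_gf \<beta> (\<alpha> * (b (\<tau> r) - a r))) = R"
      unfolding R_def by (rule prod.cong) (auto simp: that)
    finally show ?thesis by (simp only: mult.assoc)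
  qed
  have swapped: "ordering_gf \<alpha> \<beta> n a b (\<sigma> \<circ> Transposition.transpose i j) =
      match_gf \<beta> (\<alpha> * (b (\<sigma> j) - a i)) * match_gf \<beta> (\<alpha> * (b (\<sigma> i) - a j)) * R"
    using split[of "\<sigma> \<circ> Transposition.transpose i j"] by simp
  have "upper_tail (Suc l) (ordering_gf \<alpha> \<beta> n a b (\<sigma> \<circ> Transposition.transpose i j)) -
           upper_tail (Suc l) (ordering_gf \<alpha> \<beta> n a b \<sigma>) =
    ((\<alpha> * (b (\<sigma> j) - a i)) * (\<alpha> * (b (\<sigma> i) - a j)) - (\<alpha> * (b (\<sigma> i) - a i)) * (\<alpha> * (b (\<sigma> j) - a j))) *
      coeff ([:-1, 0, 1:] * ([:1, 1:] * R)) l"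
    unfolding split[OF refl] swapped by (rule upper_tail_swap_factors) (simp add: algebra_simps)
  also have "(\<alpha> * (b (\<sigma> j) - a i)) * (\<alpha> * (b (\<sigma> i) - a j)) - (\<alpha> * (b (\<sigma> i) - a i)) * (\<alpha> * (b (\<sigma> j) - a j)) =
      \<alpha>\<^sup>2 * (a i - a j) * (b (\<sigma> j) - b (\<sigma> i))"
    by (simp add: power2_eq_square algebra_simps)
  finally show ?thesis by (simp only: R_def)
qed

text \<open>
  The least number that is not yet a fixed point can be made one by a single transposition, and this
  transposition removes an inversion.
\<close>

lemma permutes_le_identity:
  fixes F :: "(nat \<Rightarrow> nat) \<Rightarrow> real"
  assumes swap: "\<And>\<tau> i j. \<tau> permutes {1..n} \<Longrightarrow> i \<in> {1..n} \<Longrightarrow> j \<in> {1..n} \<Longrightarrow> i < j \<Longrightarrow> \<tau> j < \<tau> i \<Longrightarrow>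
      F \<tau> \<le> F (\<tau> \<circ> Transposition.transpose i j)"
    and "\<tau> permutes {1..n}"
  shows "F \<tau> \<le> F id"
  using assms(2)
proof (induction "card {i. \<tau> i \<noteq> i}" arbitrary: \<tau> rule: less_induct)
  case less
  show ?case
  proof (cases "\<tau> = id")
    case False
    then have ex: "\<exists>i. \<tau> i \<noteq> i" by (auto simp: fun_eq_iff)
    define i where "i = (LEAST i. \<tau> i \<noteq> i)"
    have i: "\<tau> i \<noteq> i" unfolding i_def using ex by (rule LeastI_ex)
    have fix_below: "\<tau> r = r" if "r < i" for r using not_less_Least[of r "\<lambda>i. \<tau> i \<noteq> i"] that unfolding i_def by blast
    have inj: "inj \<tau>" using less.prems by (rule permutes_inj)
    obtain j where j: "\<tau> j = i" using permutes_surj[OF less.prems] by (metis surj_def)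
    have in_n: "r \<in> {1..n}" if "\<tau> r \<noteq> r" for r using less.prems that by (meson permutes_not_in)
    have "i < j" using i j fix_below[of j] by (metis linorder_neqE_nat)
    moreover have "i < \<tau> i" using i fix_below[of "\<tau> i"] injD[OF inj] by (metis linorder_neqE_nat)
    ultimately have ij: "i < j" "\<tau> j < \<tau> i" "i \<in> {1..n}" "j \<in> {1..n}"
      using in_n[OF i] in_n[of j] j by auto
    define \<tau>' where "\<tau>' = \<tau> \<circ> Transposition.transpose i j"
    have p': "\<tau>' permutes {1..n}"
      unfolding \<tau>'_def by (intro permutes_compose permutes_swap_id less.prems ij)
    have "{r. \<tau>' r \<noteq> r} \<subset> {r. \<tau> r \<noteq> r}"
    proof
      show "{r. \<tau>' r \<noteq> r} \<subseteq> {r. \<tau> r \<noteq> r}" using i j ij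
        by (auto simp: \<tau>'_def Transposition.transpose_def split: if_splits)
      show "{r. \<tau>' r \<noteq> r} \<noteq> {r. \<tau> r \<noteq> r}"
      proof -
        have "i \<in> {r. \<tau> r \<noteq> r}" "i \<notin> {r. \<tau>' r \<noteq> r}" using i j by (auto simp: \<tau>'_def)
        then show ?thesis by blast
      qed
    qed
    moreover have "finite {r. \<tau> r \<noteq> r}" using in_n by (auto intro: finite_subset[of _ "{1..n}"])
    ultimately have "card {r. \<tau>' r \<noteq> r} < card {r. \<tau> r \<noteq> r}" by (intro psubset_card_mono)
    then have "F \<tau>' \<le> F id" using p' by (rule less.hyps)
    moreover have "F \<tau> \<le> F \<tau>'" unfolding \<tau>'_def by (rule swap) (use ij less.prems in auto)
    ultimately show ?thesis by simp
  qed auto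
qed

section \<open>Orderings of two teams\<close>

lemma linear_model_offset_bound:
  assumes "linear_model \<alpha> \<beta> n a b M X" "\<alpha> > 0" "i \<in> {1..n}" "j \<in> {1..n}"
  shows "\<bar>\<alpha> * (b j - a i)\<bar> < \<beta>"
proof -
  have "b j - a i \<in> {- (\<beta> / \<alpha>)<..<\<beta> / \<alpha>} \<inter> {(\<beta> - 1) / \<alpha><..<(1 - \<beta>) / \<alpha>}"
    using assms unfolding linear_model_def by blast
  then have "b j - a i \<in> {- (\<beta> / \<alpha>)<..<\<beta> / \<alpha>}" by (rule IntD1)
  then show ?thesis using assms(2) by (simp add: field_simps abs_less_iff)
qed

lemma linear_model_prob_score_ge:
  assumes lm: "linear_model \<alpha> \<beta> n a b M X" and \<sigma>: "\<sigma> permutes {1..n}"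
  shows "\<P>(\<omega> in M. real K / 2 \<le> total_score n X \<sigma> \<omega>) = upper_tail K (ordering_gf \<alpha> \<beta> n a b \<sigma>)"
proof -
  interpret prob_space M using lm by (simp add: linear_model_def)
  have perm: "\<sigma> i \<in> {1..n}" if "i \<in> {1..n}" for i using permutes_in_image[OF \<sigma>] that by blast
  have X: "\<forall>\<omega>\<in>space M. X (\<sigma> i) i \<omega> \<in> {0, 1 / 2, 1}"
      "prob {\<omega> \<in> space M. X (\<sigma> i) i \<omega> = 1} = \<alpha> * (b (\<sigma> i) - a i) + \<beta>"
      "prob {\<omega> \<in> space M. X (\<sigma> i) i \<omega> = 0} = - \<alpha> * (b (\<sigma> i) - a i) + \<beta>"
      "prob {\<omega> \<in> space M. X (\<sigma> i) i \<omega> = 1 / 2} = 1 - 2 * \<beta>"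
    if "i \<in> {1..n}" for i
    using lm that perm[OF that] unfolding linear_model_def by blast+
  have "indep_vars (\<lambda>_. borel) (\<lambda>i. X (\<sigma> i) i) {1..n}"
    using lm \<sigma> unfolding linear_model_def by blast
  then show ?thesis
    unfolding total_score_def ordering_gf_def
    by (rule prob_score_ge[OF finite_atLeastAtMost]) (use X in auto)
qed

text \<open>
  A match with offset \<open>x\<close> has mean \<open>1 / 2 + x\<close>, and the offsets of an ordering always have the same
  sum (\<open>sum_offsets_permutes\<close>). Hence the expected score does not depend on the ordering.
\<close>

lemma linear_model_expected_score:
  assumes lm: "linear_model \<alpha> \<beta> n a b M X" and \<sigma>: "\<sigma> permutes {1..n}"
  shows "expected_score n M X \<sigma> = real n / 2 + (\<Sum>i = 1..n. \<alpha> * (b (\<sigma> i) - a i))"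
proof -
  interpret prob_space M using lm by (simp add: linear_model_def)
  have E: "integrable M (X (\<sigma> i) i)" "expectation (X (\<sigma> i) i) = 1 / 2 + \<alpha> * (b (\<sigma> i) - a i)"
    if i: "i \<in> {1..n}" for i
  proof -
    have si: "\<sigma> i \<in> {1..n}" using permutes_in_image[OF \<sigma>] i by blast
    have X: "X (\<sigma> i) i \<in> borel_measurable M" "\<forall>\<omega>\<in>space M. X (\<sigma> i) i \<omega> \<in> {0, 1 / 2, 1}"
      "prob {\<omega> \<in> space M. X (\<sigma> i) i \<omega> = 1} = \<alpha> * (b (\<sigma> i) - a i) + \<beta>"
      "prob {\<omega> \<in> space M. X (\<sigma> i) i \<omega> = 1 / 2} = 1 - 2 * \<beta>"
      using lm i si unfolding linear_model_def by blast+
    note * = finite_valued_integral[of "{0, 1 / 2, 1}" "X (\<sigma> i) i" "\<lambda>v. v"]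
    show "integrable M (X (\<sigma> i) i)" using *(1) X by simp
    have "expectation (X (\<sigma> i) i) = (\<Sum>v\<in>{0, 1 / 2, 1}. v * prob {\<omega> \<in> space M. X (\<sigma> i) i \<omega> = v})"
      using *(2) X by blast
    also have "\<dots> = 1 / 2 * prob {\<omega> \<in> space M. X (\<sigma> i) i \<omega> = 1 / 2} + prob {\<omega> \<in> space M. X (\<sigma> i) i \<omega> = 1}"
      by simp
    also have "\<dots> = 1 / 2 + \<alpha> * (b (\<sigma> i) - a i)" by (simp only: X) (simp add: field_simps)
    finally show "expectation (X (\<sigma> i) i) = 1 / 2 + \<alpha> * (b (\<sigma> i) - a i)" .
  qed
  have "expected_score n M X \<sigma> = (\<Sum>i = 1..n. expectation (X (\<sigma> i) i))"
    unfolding expected_score_def total_score_def by (rule Bochner_Integration.integral_sum) (rule E)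
  also have "\<dots> = (\<Sum>i = 1..n. 1 / 2 + \<alpha> * (b (\<sigma> i) - a i))" by (rule sum.cong) (simp_all add: E)
  finally show ?thesis by (simp add: sum.distrib)
qed

lemma sum_offsets_permutes:
  fixes a b :: "nat \<Rightarrow> real"
  assumes "\<sigma> permutes {1..n}"
  shows "(\<Sum>i = 1..n. \<alpha> * (b (\<sigma> i) - a i)) = (\<Sum>i = 1..n. \<alpha> * (b i - a i))"
  using sum.permute[OF assms, of b]
  by (simp add: sum_distrib_left[symmetric] sum_subtractf comp_def)

lemma coeff_swap_gain:
  fixes U :: "real poly"
  shows "coeff ([:-1, 0, 1:] * U) l = (if l < 2 then 0 else coeff U (l - 2)) - coeff U l"
  by (auto simp: coeff_pCons split: nat.splits)

text \<open>
  Removing the matches \<open>i\<close> and \<open>j\<close> lowers the mean \<open>m\<close> of twice the total score by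
  \<open>2 + 2 (x\<^sub>i + x\<^sub>j)\<close>, which lies between \<open>0\<close> and \<open>4\<close> since \<open>\<beta> < 1 / 2\<close>. So \<open>match_product_mode\<close>
  applies to the remaining matches at the indices \<open>l - 2\<close> and \<open>l\<close>.
\<close>

lemma swap_gain_sign:
  fixes x :: "nat \<Rightarrow> real"
  assumes \<beta>: "0 < \<beta>" "\<beta> < 1 / 2" and x: "\<And>r. r \<in> {1..n} \<Longrightarrow> \<bar>x r\<bar> < \<beta>"
    and ij: "i \<in> {1..n}" "j \<in> {1..n}" "i \<noteq> j"
  defines "U \<equiv> [:1, 1:] * (\<Prod>r\<in>{1..n} - {i} - {j}. match_gf \<beta> (x r))"
    and "m \<equiv> real n + 2 * (\<Sum>r = 1..n. x r)"
  shows "m + 5 \<le> real (Suc l) \<Longrightarrow> 0 \<le> coeff ([:-1, 0, 1:] * U) l"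
    and "real (Suc l) \<le> m - 4 \<Longrightarrow> coeff ([:-1, 0, 1:] * U) l \<le> 0"
proof -
  define S where "S = {1..n} - {i} - {j}"
  define mS where "mS = card S + 2 * sum x S"
  have S: "finite S" "\<And>r. r \<in> S \<Longrightarrow> \<bar>x r\<bar> < \<beta>" using x by (auto simp: S_def)
  have card: "real (card S) = real n - 2" using ij by (simp add: S_def)
  have "sum x {1..n} = x i + (x j + sum x S)"
    unfolding S_def using ij by (subst sum.remove[of _ i], simp, simp, subst sum.remove[of "{1..n} - {i}" j]) auto
  then have m: "m = mS + 2 + 2 * x i + 2 * x j" by (simp add: m_def mS_def card)
  have mS0: "0 \<le> mS"
  proof -
    have "0 \<le> (\<Sum>r\<in>S. 1 + 2 * x r)" by (rule sum_nonneg) (use S(2) \<beta> in force)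
    then show ?thesis by (simp add: mS_def sum.distrib sum_distrib_left)
  qed
  note bounds = x[OF ij(1)] x[OF ij(2)]
  have U0: "0 \<le> coeff U k" for k
  proof -
    have "0 \<le> coeff (\<Prod>r\<in>S. match_gf \<beta> (x r)) k" for k
      by (rule coeff_prod_nonneg)
         (use S(2) \<beta> in \<open>force simp: match_gf_def coeff_pCons abs_less_iff split: nat.splits\<close>)
    then show ?thesis by (auto simp: U_def S_def coeff_pCons split: nat.splits)
  qed
  show "0 \<le> coeff ([:-1, 0, 1:] * U) l" if l: "m + 5 \<le> real (Suc l)"
  proof -
    \<comment> \<open>The mean of the remaining matches is nonnegative, so \<open>l - 2\<close> does not truncate.\<close>
    have "real l > 2" using l m mS0 bounds \<beta> by linarith
    then obtain k where k: "l = k + 2" by (metis add.commute le_Suc_ex less_imp_le of_nat_less_iff of_nat_numeral)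
    have "mS + 1 \<le> real k" using l m bounds \<beta> unfolding k by simp
    then obtain c where "0 \<le> c" "c < 1" "coeff U (k + 2) \<le> c * coeff U k"
      using match_product_mode(1)[where x = x, OF S(1) \<beta> S(2)] unfolding mS_def U_def S_def[symmetric] by blast
    moreover have "c * coeff U k \<le> 1 * coeff U k" using calculation U0 by (intro mult_right_mono) auto
    ultimately show ?thesis unfolding coeff_swap_gain k by simp
  qed
  show "coeff ([:-1, 0, 1:] * U) l \<le> 0" if l: "real (Suc l) \<le> m - 4"
  proof (cases "l < 2")
    case True
    then show ?thesis using U0[of l] unfolding coeff_swap_gain by simp
  next
    case False
    then obtain k where k: "l = k + 2" by (metis add.commute le_Suc_ex not_less)
    have "real k + 2 \<le> mS" using l m bounds \<beta> unfolding k by simp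
    then obtain c where "0 \<le> c" "c < 1" "coeff U k \<le> c * coeff U (k + 2)"
      using match_product_mode(2)[where x = x, OF S(1) \<beta> S(2)] unfolding mS_def U_def S_def[symmetric] by blast
    moreover have "c * coeff U (k + 2) \<le> 1 * coeff U (k + 2)" using calculation U0 by (intro mult_right_mono) auto
    ultimately show ?thesis unfolding coeff_swap_gain k by simp
  qed
qed

lemma strong_vs_weak_permutes: "strong_vs_weak n permutes {1..n}"
proof (rule bij_imp_permutes)
  show "bij_betw (strong_vs_weak n) {1..n} {1..n}"
    by (rule bij_betw_byWitness[where f' = "strong_vs_weak n"]) (auto simp: strong_vs_weak_def)
qed (auto simp: strong_vs_weak_def)

lemma strong_vs_weak_involution: "strong_vs_weak n \<circ> strong_vs_weak n = id"
  by (auto simp: strong_vs_weak_def fun_eq_iff)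

lemma linear_model_swap:
  fixes K :: nat
  assumes lm: "linear_model \<alpha> \<beta> n a b M X" and \<alpha>: "\<alpha> > 0" and \<beta>: "0 < \<beta>" "\<beta> < 1 / 2"
    and \<tau>: "\<tau> permutes {1..n}" and ij: "i \<in> {1..n}" "j \<in> {1..n}" "i < j"
  defines "\<mu> \<equiv> real n / 2 + (\<Sum>i = 1..n. \<alpha> * (b i - a i))"
    and "F \<equiv> \<lambda>\<tau>. upper_tail K (ordering_gf \<alpha> \<beta> n a b \<tau>)"
  shows "2 * \<mu> + 5 \<le> real K \<Longrightarrow> \<tau> j < \<tau> i \<Longrightarrow> F \<tau> \<le> F (\<tau> \<circ> Transposition.transpose i j)"
    and "real K \<le> 2 * \<mu> - 4 \<Longrightarrow> \<tau> i < \<tau> j \<Longrightarrow> F \<tau> \<le> F (\<tau> \<circ> Transposition.transpose i j)"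
proof -
  define x where "x r = \<alpha> * (b (\<tau> r) - a r)" for r
  have perm: "\<tau> r \<in> {1..n}" if "r \<in> {1..n}" for r using permutes_in_image[OF \<tau>] that by blast
  have x: "\<bar>x r\<bar> < \<beta>" if "r \<in> {1..n}" for r
    unfolding x_def using linear_model_offset_bound[OF lm \<alpha>] that perm[OF that] by blast
  have \<mu>2: "2 * \<mu> = real n + 2 * (\<Sum>r = 1..n. x r)"
    unfolding \<mu>_def x_def using sum_offsets_permutes[OF \<tau>, of \<alpha> b a] by simp
  have mono: "a j \<le> a i" "b v \<le> b u" if "u \<in> {1..n}" "v \<in> {1..n}" "u \<le> v" for u v
    using lm ij that unfolding linear_model_def by (meson less_imp_le)+
  define gain where "gain l = coeff ([:-1, 0, 1:] * ([:1, 1:] * (\<Prod>r\<in>{1..n} - {i} - {j}. match_gf \<beta> (x r)))) l" for l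
  have diff: "F (\<tau> \<circ> Transposition.transpose i j) - F \<tau> = \<alpha>\<^sup>2 * (a i - a j) * (b (\<tau> j) - b (\<tau> i)) * gain l"
    if "K = Suc l" for l
    unfolding F_def that gain_def x_def using ij by (intro upper_tail_swap_players) auto
  have a: "0 \<le> a i - a j" using mono(1)[OF ij(1) ij(2)] ij by simp
  have ne: "i \<noteq> j" using ij by simp
  note sign = swap_gain_sign[where x = x, OF \<beta> x ij(1,2) ne, folded \<mu>2, folded gain_def]
  show "F \<tau> \<le> F (\<tau> \<circ> Transposition.transpose i j)" if K: "2 * \<mu> + 5 \<le> real K" and lt: "\<tau> j < \<tau> i"
  proof (cases K)
    case (Suc l)
    have "0 \<le> b (\<tau> j) - b (\<tau> i)" using mono(2)[OF perm[OF ij(2)] perm[OF ij(1)]] lt by simp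
    moreover have "0 \<le> gain l" using sign(1) K unfolding Suc by blast
    ultimately have "0 \<le> \<alpha>\<^sup>2 * (a i - a j) * (b (\<tau> j) - b (\<tau> i)) * gain l"
      using a by (intro mult_nonneg_nonneg zero_le_power2)
    then show ?thesis using diff[OF Suc] by simp
  qed (simp add: F_def upper_tail_def)
  show "F \<tau> \<le> F (\<tau> \<circ> Transposition.transpose i j)" if K: "real K \<le> 2 * \<mu> - 4" and lt: "\<tau> i < \<tau> j"
  proof (cases K)
    case (Suc l)
    have "b (\<tau> j) - b (\<tau> i) \<le> 0" using mono(2)[OF perm[OF ij(1)] perm[OF ij(2)]] lt by simp
    moreover have "gain l \<le> 0" using sign(2) K unfolding Suc by blast
    ultimately have "0 \<le> \<alpha>\<^sup>2 * (a i - a j) * ((b (\<tau> j) - b (\<tau> i)) * gain l)"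
      using a by (intro mult_nonneg_nonneg mult_nonpos_nonpos zero_le_power2)
    then show ?thesis using diff[OF Suc] by (simp add: mult.assoc)
  qed (simp add: F_def upper_tail_def)
qed

text \<open>
  For large \<open>k\<close> no exchange that sorts the ordering does harm. For small \<open>k\<close> the same is true of the
  exchanges in the opposite direction, which composition with the reversal turns into sorting ones.
\<close>

lemma linear_model_optimal:
  assumes lm: "linear_model \<alpha> \<beta> n a b M X" and \<alpha>: "\<alpha> > 0" and \<beta>: "0 < \<beta>" "\<beta> < 1 / 2"
    and k: "k \<in> half_integers_upto n"
  defines "\<mu> \<equiv> real n / 2 + (\<Sum>i = 1..n. \<alpha> * (b i - a i))"
  shows "\<mu> + 2.5 \<le> k \<Longrightarrow> optimal_ordering n M X k strong_vs_strong"
    and "k \<le> \<mu> - 2 \<Longrightarrow> optimal_ordering n M X k (strong_vs_weak n)"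
proof -
  obtain K where K: "k = real K / 2" using k by (auto simp: half_integers_upto_def)
  define F where "F \<tau> = upper_tail K (ordering_gf \<alpha> \<beta> n a b \<tau>)" for \<tau>
  have prob: "\<P>(\<omega> in M. k \<le> total_score n X \<tau> \<omega>) = F \<tau>" if "\<tau> permutes {1..n}" for \<tau>
    unfolding F_def K by (rule linear_model_prob_score_ge[OF lm that])
  note swap = linear_model_swap[OF lm \<alpha> \<beta>, where K = K, folded F_def \<mu>_def]
  show "optimal_ordering n M X k strong_vs_strong" if ge: "\<mu> + 2.5 \<le> k"
  proof -
    have "F \<tau> \<le> F id" if "\<tau> permutes {1..n}" for \<tau>
      by (rule permutes_le_identity[OF _ that], rule swap(1)) (use ge in \<open>auto simp: K\<close>)
    moreover have "strong_vs_strong = id" by (auto simp: strong_vs_strong_def)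
    ultimately show ?thesis by (auto simp: optimal_ordering_def prob permutes_id)
  qed
  show "optimal_ordering n M X k (strong_vs_weak n)" if le: "k \<le> \<mu> - 2"
  proof -
    define rev where "rev = strong_vs_weak n"
    have rev: "rev permutes {1..n}" unfolding rev_def by (rule strong_vs_weak_permutes)
    have rev_less: "rev u < rev v" if "v < u" "u \<in> {1..n}" "v \<in> {1..n}" for u v
      using that by (auto simp: rev_def strong_vs_weak_def)
    have "F \<tau> \<le> F rev" if \<tau>: "\<tau> permutes {1..n}" for \<tau>
    proof -
      have "F (rev \<circ> (rev \<circ> \<tau>)) \<le> F (rev \<circ> id)"
      proof (rule permutes_le_identity[where F = "\<lambda>\<tau>. F (rev \<circ> \<tau>)"])
        show "rev \<circ> \<tau> permutes {1..n}" by (rule permutes_compose[OF \<tau> rev])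
        fix \<rho> i j assume *: "\<rho> permutes {1..n}" "i \<in> {1..n}" "j \<in> {1..n}" "i < j" "\<rho> j < \<rho> i"
        have "rev (\<rho> i) < rev (\<rho> j)"
          using * permutes_in_image[OF *(1)] by (intro rev_less) blast+
        then show "F (rev \<circ> \<rho>) \<le> F (rev \<circ> (\<rho> \<circ> Transposition.transpose i j))"
          using swap(2)[OF permutes_compose[OF *(1) rev] *(2-4)] le by (simp add: K comp_assoc)
      qed
      then show ?thesis using strong_vs_weak_involution[of n]
        by (simp add: comp_assoc[symmetric] rev_def)
    qed
    then show ?thesis using strong_vs_weak_permutes[of n] by (simp add: optimal_ordering_def prob rev_def)
  qed
qed

section \<open>Teams with different optimal orderings\<close>

text \<open>
  All matches can be taken independent, as coordinates of a finite product of three-point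
  distributions. The function \<open>points\<close> corrects the coordinates on a null set, because the possible
  outcomes are prescribed at every point of the space.
\<close>

lemma linear_model_exists:
  fixes a b :: "nat \<Rightarrow> real"
  assumes \<alpha>: "\<alpha> > 0" and \<beta>: "0 < \<beta>" "\<beta> < 1 / 2" and n: "1 \<le> n"
    and sorted: "\<And>i j. i \<in> {1..n} \<Longrightarrow> j \<in> {1..n} \<Longrightarrow> i \<le> j \<Longrightarrow> a j \<le> a i \<and> b j \<le> b i"
    and bound: "\<And>i j. i \<in> {1..n} \<Longrightarrow> j \<in> {1..n} \<Longrightarrow> \<bar>\<alpha> * (b j - a i)\<bar> < \<beta>"
  shows "\<exists>(M :: (nat \<times> nat \<Rightarrow> real) measure) X. linear_model \<alpha> \<beta> n a b M X"
proof -
  define I where "I = {1..n} \<times> {1..n}"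
  define outcomes where "outcomes = (\<lambda>(j, i). let x = \<alpha> * (b j - a i) in
    [(0 :: real, \<beta> - x), (1 / 2, 1 - 2 * \<beta>), (1, \<beta> + x)])"
  define P where "P = Pi_pmf I 0 (\<lambda>m. pmf_of_list (outcomes m))"
  define points where "points v = (if v \<in> {0, 1 / 2, 1} then v else 0)" for v :: real
  define X where "X j i \<omega> = points (\<omega> (j, i))" for j i :: nat and \<omega> :: "nat \<times> nat \<Rightarrow> real"
  have fin: "finite I" by (simp add: I_def)
  have wf: "pmf_of_list_wf (outcomes (j, i))" if "i \<in> {1..n}" "j \<in> {1..n}" for i j
    using bound[OF that] \<beta> by (intro pmf_of_list_wfI) (auto simp: outcomes_def Let_def)
  have X: "measure (measure_pmf P) {\<omega> \<in> space (measure_pmf P). X j i \<omega> = v} =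
      sum_list (map snd (filter (\<lambda>z. points (fst z) = v) (outcomes (j, i))))"
    if "i \<in> {1..n}" "j \<in> {1..n}" for i j v
  proof -
    have "measure (measure_pmf P) {\<omega> \<in> space (measure_pmf P). X j i \<omega> = v} =
        measure (measure_pmf (map_pmf (\<lambda>\<omega>. \<omega> (j, i)) P)) {w. points w = v}"
      by (simp add: X_def vimage_def)
    also have "map_pmf (\<lambda>\<omega>. \<omega> (j, i)) P = pmf_of_list (outcomes (j, i))"
      unfolding P_def using that by (subst Pi_pmf_component[OF fin]) (auto simp: I_def)
    finally show ?thesis by (simp add: measure_pmf_of_list[OF wf[OF that]])
  qed
  have indep: "prob_space.indep_vars (measure_pmf P) (\<lambda>_. borel) (\<lambda>i. X (\<sigma> i) i) {1..n}"
    if \<sigma>: "\<sigma> permutes {1..n}" for \<sigma>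
  proof -
    have "prob_space.indep_vars (measure_pmf P) (\<lambda>_. count_space UNIV) (\<lambda>m \<omega>. \<omega> m) I"
      using indep_vars_Pi_pmf[OF fin, of 0 "\<lambda>m. pmf_of_list (outcomes m)"] by (simp add: P_def)
    then have "prob_space.indep_vars (measure_pmf P) (\<lambda>i. PiM {(\<sigma> i, i)} (\<lambda>_. count_space UNIV))
        (\<lambda>i \<omega>. restrict (\<lambda>m. \<omega> m) {(\<sigma> i, i)}) {1..n}"
    proof (rule prob_space.indep_vars_restrict[OF measure_pmf.prob_space_axioms])
      show "{(\<sigma> i, i)} \<subseteq> I" if "i \<in> {1..n}" for i
        using that permutes_in_image[OF \<sigma>, of i] unfolding I_def by blast
      show "disjoint_family_on (\<lambda>i. {(\<sigma> i, i)}) {1..n}"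
        by (auto simp: disjoint_family_on_def)
    qed
    then have "prob_space.indep_vars (measure_pmf P) (\<lambda>_. borel) (\<lambda>i \<omega>. (\<lambda>f. points (f (\<sigma> i, i))) (restrict (\<lambda>m. \<omega> m) {(\<sigma> i, i)})) {1..n}"
    proof (rule prob_space.indep_vars_compose2[OF measure_pmf.prob_space_axioms])
      fix i
      have "(\<lambda>f. f (\<sigma> i, i)) \<in> measurable (PiM {(\<sigma> i, i)} (\<lambda>_. count_space UNIV)) (count_space (UNIV :: real set))"
        by (rule measurable_component_singleton) simp
      then show "(\<lambda>f. points (f (\<sigma> i, i))) \<in> measurable (PiM {(\<sigma> i, i)} (\<lambda>_. count_space UNIV)) borel"
        by (rule measurable_compose) simp
    qed
    then show ?thesis by (simp add: X_def[abs_def])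
  qed
  have "linear_model \<alpha> \<beta> n a b (measure_pmf P) X"
    unfolding linear_model_def
  proof (intro conjI ballI allI impI)
    show "1 \<le> n" by (rule n)
    show "prob_space (measure_pmf P)" by (rule measure_pmf.prob_space_axioms)
    fix i j assume ij: "i \<in> {1..n}" "j \<in> {1..n}"
    show "a j \<le> a i" "b j \<le> b i" if "i \<le> j" using sorted[OF ij that] by auto
    have "- \<beta> < \<alpha> * (b j - a i)" "\<alpha> * (b j - a i) < \<beta>" using bound[OF ij] by auto
    then have "- (\<beta> / \<alpha>) < b j - a i" "b j - a i < \<beta> / \<alpha>"
        "(\<beta> - 1) / \<alpha> < b j - a i" "b j - a i < (1 - \<beta>) / \<alpha>"
      using \<alpha> \<beta> by (auto simp: pos_divide_less_eq pos_less_divide_eq minus_divide_left mult.commute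
        simp del: minus_divide_left[symmetric])
    then show "b j - a i \<in> {- (\<beta> / \<alpha>)<..<\<beta> / \<alpha>} \<inter> {(\<beta> - 1) / \<alpha><..<(1 - \<beta>) / \<alpha>}" by simp
    show "X j i \<in> borel_measurable (measure_pmf P)" by simp
    show "X j i \<omega> \<in> {0, 1 / 2, 1}" for \<omega> by (simp add: X_def points_def)
    show "measure (measure_pmf P) {\<omega> \<in> space (measure_pmf P). X j i \<omega> = 1} = \<alpha> * (b j - a i) + \<beta>"
      "measure (measure_pmf P) {\<omega> \<in> space (measure_pmf P). X j i \<omega> = 0} = - \<alpha> * (b j - a i) + \<beta>"
      "measure (measure_pmf P) {\<omega> \<in> space (measure_pmf P). X j i \<omega> = 1 / 2} = 1 - 2 * \<beta>"
      unfolding X[OF ij] by (simp_all add: outcomes_def points_def Let_def)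
  qed (rule indep)
  then show ?thesis by blast
qed

text \<open>
  The induction moves one factor \<open>B\<close> or \<open>C\<close> at a time into \<open>A\<close>, so \<open>A\<close> has to be arbitrary.
\<close>

lemma coeff_pencil_power_poly:
  fixes A B C :: "'a :: comm_ring_1 poly"
  shows "\<exists>q. \<forall>x. coeff (A * (B + smult x C) ^ N) l = poly q x"
proof (induction N arbitrary: A)
  case 0
  show ?case by (intro exI[of _ "[:coeff A l:]"]) simp
next
  case (Suc N)
  obtain q where q: "\<And>x. coeff (A * B * (B + smult x C) ^ N) l = poly q x" using Suc[of "A * B"] by blast
  obtain r where r: "\<And>x. coeff (A * C * (B + smult x C) ^ N) l = poly r x" using Suc[of "A * C"] by blast
  have "coeff (A * (B + smult x C) ^ Suc N) l = poly (q + [:0, 1:] * r) x" for x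
  proof -
    have "A * (B + smult x C) ^ Suc N = A * B * (B + smult x C) ^ N + smult x (A * C * (B + smult x C) ^ N)"
      by (simp add: algebra_simps)
    then show ?thesis by (simp add: q r)
  qed
  then show ?case by blast
qed

text \<open>
  Let \<open>s\<close> be the supremum of the points of \<open>[lo, hi]\<close> where \<open>q\<close> is positive. Positive values occur
  just below \<open>s\<close> or at \<open>s\<close>. Above \<open>s\<close> the polynomial is nonpositive and has only finitely many roots,
  so negative values occur arbitrarily close to \<open>s\<close>.
\<close>

lemma poly_close_sign_change:
  fixes q :: "real poly"
  assumes "lo < hi" "0 < poly q lo" "poly q hi < 0" "0 < \<epsilon>"
  shows "\<exists>x y. x \<in> {lo..hi} \<and> y \<in> {lo..hi} \<and> \<bar>x - y\<bar> < \<epsilon> \<and> 0 < poly q x \<and> poly q y < 0"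
proof -
  define A where "A = {x \<in> {lo..hi}. 0 < poly q x}"
  define s where "s = Sup A"
  have A: "lo \<in> A" "bdd_above A" using assms by (auto simp: A_def intro!: bdd_aboveI[of _ hi])
  have s: "lo \<le> s" "s \<le> hi"
    unfolding s_def using A by (auto intro: cSup_upper cSup_least simp: A_def)
  have "s \<in> closure A" unfolding s_def using A by (intro closure_contains_Sup) auto
  moreover have "closure A \<subseteq> {x. 0 \<le> poly q x}"
    by (intro closure_minimal closed_Collect_le continuous_intros) (auto simp: A_def)
  ultimately have "0 \<le> poly q s" by auto
  then have "s < hi" using s assms by (cases "s = hi") auto
  obtain x where x: "x \<in> A" "s - \<epsilon> / 2 < x"
    using less_cSup_iff[of A "s - \<epsilon> / 2"] A assms(4) by (auto simp: s_def)
  have xs: "x \<le> s" unfolding s_def using x A by (intro cSup_upper)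
  define t where "t = min hi (s + \<epsilon> / 2)"
  have "s < t" using \<open>s < hi\<close> assms(4) by (simp add: t_def)
  then have "infinite {s<..<t}" by simp
  moreover have "q \<noteq> 0" using assms by auto
  ultimately have "\<not> {s<..<t} \<subseteq> {y. poly q y = 0}" using poly_roots_finite finite_subset by blast
  then obtain y where "y \<in> {s<..<t}" "poly q y \<noteq> 0" by blast
  then have y: "s < y" "y < t" "poly q y \<noteq> 0" by auto
  have "y \<notin> A" using y cSup_upper[of y A] A by (auto simp: s_def)
  then have "poly q y < 0" using y s by (auto simp: A_def t_def)
  then show ?thesis using x xs y s
    by (intro exI[of _ x] exI[of _ y]) (auto simp: A_def t_def)
qed

text \<open>
  Here \<open>N\<close> equal matches have mean \<open>N + 2 N x\<close>. At the left end of the interval this is \<open>N - 1\<close>, at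
  the right end it is \<open>N + 2\<close>; these are the extreme cases of \<open>match_product_mode\<close> at the indices \<open>N\<close>
  and \<open>N + 2\<close>, one in each direction. Strictness comes from the factor \<open>c < 1\<close> and the positivity of
  the coefficients.
\<close>

lemma equal_offsets_gain_sign_change:
  assumes \<beta>: "0 < \<beta>" "\<beta> < 1 / 2" and N: "2 \<le> N" "1 / real N < \<beta>" and "0 < \<epsilon>"
  defines "gain \<equiv> \<lambda>x. coeff ([:-1, 0, 1:] * ([:1, 1:] * match_gf \<beta> x ^ N)) (N + 2)"
  shows "\<exists>x y. x \<in> {- 1 / (2 * real N)..1 / real N} \<and> y \<in> {- 1 / (2 * real N)..1 / real N} \<and>
    \<bar>x - y\<bar> < \<epsilon> \<and> 0 < gain x \<and> gain y < 0"
proof -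
  have "gain x = coeff ([:-1, 0, 1:] * [:1, 1:] * (match_gf \<beta> 0 + smult x [:-1, 0, 1:]) ^ N) (N + 2)" for x
    unfolding gain_def by (simp only: mult.assoc) (simp add: match_gf_def)
  then obtain q where q: "\<And>x. gain x = poly q x"
    using coeff_pencil_power_poly[of "[:-1, 0, 1:] * [:1, 1:]" "match_gf \<beta> 0" "[:-1, 0, 1:]" N "N + 2"] by metis
  define U where "U x = [:1, 1:] * match_gf \<beta> x ^ N" for x
  have gain: "gain x = coeff (U x) N - coeff (U x) (N + 2)" for x
    unfolding gain_def U_def[symmetric] coeff_swap_gain by simp
  have U: "0 < coeff (U x) k" if "\<bar>x\<bar> < \<beta>" "1 \<le> k" "k \<le> N + 2" for x k
  proof -
    have "0 < coeff (match_gf \<beta> x ^ N) j" if "j \<le> 2 * N" for j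
      using coeff_prod_match_gf_pos[of "{..<N}" \<beta> "\<lambda>_. x" j] \<beta> \<open>\<bar>x\<bar> < \<beta>\<close> that by simp
    moreover have "0 \<le> coeff (match_gf \<beta> x ^ N) j" for j
      using coeff_prod_nonneg[of "{..<N}" "\<lambda>_. match_gf \<beta> x" j] \<beta> \<open>\<bar>x\<bar> < \<beta>\<close>
      by (force simp: match_gf_def coeff_pCons abs_less_iff split: nat.splits)
    ultimately show ?thesis using that N unfolding U_def
      by (cases k) (auto intro!: add_nonneg_pos)
  qed
  note mode = match_product_mode[where S = "{..<N}" and x = "\<lambda>_. x" for x, OF finite_lessThan \<beta>,
    simplified prod_constant sum_constant card_lessThan, folded U_def]
  have "0 < gain (- 1 / (2 * real N))" (is "0 < gain ?x")
  proof -
    have x: "\<bar>?x\<bar> < \<beta>" using N by (simp add: field_simps)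
    obtain c where "0 \<le> c" "c < 1" "coeff (U ?x) (N + 2) \<le> c * coeff (U ?x) N"
      using mode(1)[of ?x N] x N by auto
    moreover have "0 < coeff (U ?x) N" using U[OF x, of N] N by simp
    moreover have "c * coeff (U ?x) N < 1 * coeff (U ?x) N"
      using calculation by (intro mult_strict_right_mono)
    ultimately show ?thesis unfolding gain by linarith
  qed
  moreover have "gain (1 / real N) < 0" (is "gain ?x < 0")
  proof -
    have x: "\<bar>?x\<bar> < \<beta>" using N by simp
    obtain c where "0 \<le> c" "c < 1" "coeff (U ?x) N \<le> c * coeff (U ?x) (N + 2)"
      using mode(2)[of ?x N] x N by auto
    moreover have "0 < coeff (U ?x) (N + 2)" using U[OF x, of "N + 2"] N by simp
    moreover have "c * coeff (U ?x) (N + 2) < 1 * coeff (U ?x) (N + 2)"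
      using calculation by (intro mult_strict_right_mono)
    ultimately show ?thesis unfolding gain by linarith
  qed
  ultimately show ?thesis
    using poly_close_sign_change[of "- 1 / (2 * real N)" "1 / real N" q \<epsilon>] N(1) \<open>0 < \<epsilon>\<close>
    unfolding q by (simp add: field_simps)
qed

text \<open>
  The advantage of a player over the weakest one in a team with a single stronger player, who has
  number \<open>1\<close>.
\<close>

definition ace :: "real \<Rightarrow> nat \<Rightarrow> real" where
  "ace g i = (if i = 1 then g else 0)"

text \<open>
  An exchange that makes the two stronger players meet, or keeps them apart, leaves \<open>n - 2\<close> matches
  between ordinary players, all with the same offset \<open>x\<close>.
\<close>

lemma swap_with_ace:
  fixes \<alpha> \<beta> x g h :: real
  assumes \<alpha>: "\<alpha> > 0" and \<sigma>: "\<sigma> permutes {1..n}" and j: "j \<in> {2..n}" and one: "\<sigma> 1 = 1 \<or> \<sigma> j = 1"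
  defines "b \<equiv> \<lambda>i. (x + ace h i) / \<alpha>" and "a \<equiv> \<lambda>i. ace g i / \<alpha>"
  shows "upper_tail (Suc l) (ordering_gf \<alpha> \<beta> n a b (\<sigma> \<circ> Transposition.transpose 1 j)) -
           upper_tail (Suc l) (ordering_gf \<alpha> \<beta> n a b \<sigma>) =
         (if \<sigma> 1 = 1 then - 1 else 1) * (g * h) *
           coeff ([:-1, 0, 1:] * ([:1, 1:] * match_gf \<beta> x ^ (n - 2))) l"
proof -
  have inj: "inj \<sigma>" using \<sigma> by (rule permutes_inj)
  have j1: "j \<noteq> 1" "j \<in> {1..n}" "1 \<in> {1..n}" using j by auto
  have "(\<Prod>r\<in>{1..n} - {1} - {j}. match_gf \<beta> (\<alpha> * (b (\<sigma> r) - a r))) = (\<Prod>r\<in>{1..n} - {1} - {j}. match_gf \<beta> x)"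
  proof (rule prod.cong[OF refl])
    fix r assume r: "r \<in> {1..n} - {1} - {j}"
    have "\<sigma> r \<noteq> 1" using one r injD[OF inj, of r 1] injD[OF inj, of r j] by auto
    then show "match_gf \<beta> (\<alpha> * (b (\<sigma> r) - a r)) = match_gf \<beta> x"
      using r \<alpha> by (simp add: a_def b_def ace_def)
  qed
  also have "\<dots> = match_gf \<beta> x ^ (n - 2)" using j1 by (simp add: numeral_2_eq_2)
  finally have R: "(\<Prod>r\<in>{1..n} - {1} - {j}. match_gf \<beta> (\<alpha> * (b (\<sigma> r) - a r))) = match_gf \<beta> x ^ (n - 2)" .
  have "\<alpha>\<^sup>2 * (a 1 - a j) * (b (\<sigma> j) - b (\<sigma> 1)) = g * (ace h (\<sigma> j) - ace h (\<sigma> 1))"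
    using \<alpha> j1 by (simp add: a_def b_def ace_def power2_eq_square field_simps)
  also have "ace h (\<sigma> j) - ace h (\<sigma> 1) = (if \<sigma> 1 = 1 then - 1 else 1) * h"
    using one injD[OF inj, of j 1] j1 by (auto simp: ace_def)
  finally have c: "\<alpha>\<^sup>2 * (a 1 - a j) * (b (\<sigma> j) - b (\<sigma> 1)) = (if \<sigma> 1 = 1 then - 1 else 1) * (g * h)"
    by simp
  show ?thesis
    unfolding upper_tail_swap_players[OF j1(3,2) j1(1)[symmetric]] R c ..
qed

lemma linear_model_ace_exists:
  assumes \<alpha>: "\<alpha> > 0" and \<beta>: "0 < \<beta>" "\<beta> < 1 / 2" and n: "1 \<le> n"
    and gh: "0 \<le> g" "0 \<le> h" and x: "- \<beta> < x - g" "x + h < \<beta>"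
  shows "\<exists>(M :: (nat \<times> nat \<Rightarrow> real) measure) X.
    linear_model \<alpha> \<beta> n (\<lambda>i. ace g i / \<alpha>) (\<lambda>i. (x + ace h i) / \<alpha>) M X"
proof (rule linear_model_exists[OF \<alpha> \<beta> n])
  show "ace g j / \<alpha> \<le> ace g i / \<alpha> \<and> (x + ace h j) / \<alpha> \<le> (x + ace h i) / \<alpha>"
    if "i \<in> {1..n}" "j \<in> {1..n}" "i \<le> j" for i j
    using that \<alpha> gh by (auto simp: ace_def divide_simps)
  show "\<bar>\<alpha> * ((x + ace h j) / \<alpha> - ace g i / \<alpha>)\<bar> < \<beta>" for i j
  proof -
    have "\<alpha> * ((x + ace h j) / \<alpha> - ace g i / \<alpha>) = x + ace h j - ace g i"
      using \<alpha> by (simp add: field_simps)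
    then show ?thesis using gh x by (auto simp: ace_def abs_less_iff)
  qed
qed

lemma sum_ace: "1 \<le> n \<Longrightarrow> (\<Sum>i = 1..n. ace g i) = g"
  by (simp add: ace_def)

text \<open>
  Take offsets \<open>x\<close> and \<open>x'\<close> at which the gain from letting the stronger players meet has opposite
  signs. An ordering that is optimal for both pairs of teams would have to let them meet for \<open>x\<close> and
  to keep them apart for \<open>x'\<close>.
\<close>

lemma optimum_depends_on_teams:
  fixes \<alpha> \<beta> :: real
  assumes \<alpha>: "\<alpha> > 0" and \<beta>: "0 < \<beta>" "\<beta> < 1 / 2"
  shows "\<exists>n a b a' b' (M :: (nat \<times> nat \<Rightarrow> real) measure) X (M' :: (nat \<times> nat \<Rightarrow> real) measure) X' \<mu>.
        linear_model \<alpha> \<beta> n a b M X \<and>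
        linear_model \<alpha> \<beta> n a' b' M' X' \<and>
        (\<forall>\<sigma>. \<sigma> permutes {1..n} \<longrightarrow> expected_score n M X \<sigma> = \<mu> \<and> expected_score n M' X' \<sigma> = \<mu>) \<and>
        (\<exists>k \<in> half_integers_upto n. k \<in> {\<mu> - 2<..<\<mu> + 2.5} \<and>
           \<not> (\<exists>\<sigma>. optimal_ordering n M X k \<sigma> \<and> optimal_ordering n M' X' k \<sigma>))"
proof -
  obtain N0 :: nat where N0: "2 / \<beta> < real N0" using reals_Archimedean2 by blast
  define N where "N = N0 + 4"
  define n where "n = N + 2"
  have N: "4 \<le> N" "2 / \<beta> < real N" using N0 by (auto simp: N_def)
  have N\<beta>: "1 / real N < \<beta> / 2" using N \<beta> by (simp add: field_simps)
  \<comment> \<open>Ordinary offsets stay below \<open>\<beta> / 2\<close> in absolute value, and the advantages \<open>g\<close> and \<open>h < 2 g\<close>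
  use up at most the other half.\<close>
  define g where "g = \<beta> / 4"
  have g: "0 < g" using \<beta> by (simp add: g_def)
  define gain where "gain x = coeff ([:-1, 0, 1:] * ([:1, 1:] * match_gf \<beta> x ^ N)) (N + 2)" for x
  obtain x x' where x: "x \<in> {- 1 / (2 * real N)..1 / real N}" "x' \<in> {- 1 / (2 * real N)..1 / real N}"
    and close: "\<bar>x - x'\<bar> < g / real n" and sign: "0 < gain x" "gain x' < 0"
    using equal_offsets_gain_sign_change[OF \<beta>, of N "g / real n"] N N\<beta> \<beta> g
    unfolding gain_def n_def by auto
  \<comment> \<open>The advantage of B's best player that compensates for the change of \<open>x\<close> in the mean; it is
  positive because \<open>x\<close> and \<open>x'\<close> are closer than \<open>g / n\<close>.\<close>
  define h where "h = g + real n * (x - x')"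
  have "\<bar>real n * (x - x')\<bar> < g"
    using close unfolding abs_mult by (simp add: n_def field_simps)
  then have h: "0 < h" "h < 2 * g" by (auto simp: h_def)
  have xb: "- (\<beta> / 2) < y" "y < \<beta> / 2" if "y \<in> {- 1 / (2 * real N)..1 / real N}" for y
  proof -
    have "1 / (2 * real N) \<le> 1 / real N" using N(1) by (simp add: divide_simps)
    then show "- (\<beta> / 2) < y" "y < \<beta> / 2" using that N\<beta> by auto
  qed
  define a where "a = (\<lambda>i. ace g i / \<alpha>)"
  define b where "b = (\<lambda>i. (x + ace g i) / \<alpha>)"
  define b' where "b' = (\<lambda>i. (x' + ace h i) / \<alpha>)"
  obtain M :: "(nat \<times> nat \<Rightarrow> real) measure" and X where M: "linear_model \<alpha> \<beta> n a b M X"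
    unfolding a_def b_def using linear_model_ace_exists[OF \<alpha> \<beta>, of n g g x] xb[OF x(1)] g
    by (auto simp: n_def g_def)
  obtain M' :: "(nat \<times> nat \<Rightarrow> real) measure" and X' where M': "linear_model \<alpha> \<beta> n a b' M' X'"
    unfolding a_def b'_def using linear_model_ace_exists[OF \<alpha> \<beta>, of n g h x'] xb[OF x(2)] g h
    by (auto simp: n_def g_def)
  define \<mu> where "\<mu> = real n / 2 + real n * x"
  have n1: "1 \<le> n" by (simp add: n_def)
  have total: "(\<Sum>i = 1..n. \<alpha> * ((y + ace u i) / \<alpha> - ace g i / \<alpha>)) = real n * y + u - g" for y u
  proof -
    have "(\<Sum>i = 1..n. \<alpha> * ((y + ace u i) / \<alpha> - ace g i / \<alpha>)) = (\<Sum>i = 1..n. y + ace u i - ace g i)"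
      using \<alpha> by (intro sum.cong) (auto simp: field_simps)
    also have "\<dots> = real n * y + u - g"
      unfolding sum_subtractf sum.distrib sum_ace[OF n1] by simp
    finally show ?thesis .
  qed
  have E: "expected_score n M X \<sigma> = \<mu>" "expected_score n M' X' \<sigma> = \<mu>" if "\<sigma> permutes {1..n}" for \<sigma>
    using linear_model_expected_score[OF M that] linear_model_expected_score[OF M' that] total[of x g] total[of x' h]
    unfolding sum_offsets_permutes[OF that]
    by (simp_all add: a_def b_def b'_def \<mu>_def h_def algebra_simps)
  define k where "k = real (Suc (N + 2)) / 2"
  have k: "k \<in> half_integers_upto n"
    unfolding half_integers_upto_def k_def n_def by (intro CollectI exI[of _ "Suc (N + 2)"]) auto
  have kmu: "k \<in> {\<mu> - 2<..<\<mu> + 2.5}"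
  proof -
    have "real n * x \<le> real n * (1 / real N)" "real n * (- 1 / (2 * real N)) \<le> real n * x"
      by (rule mult_left_mono; use x(1) in simp)+
    moreover have "real n * (1 / real N) \<le> 3 / 2" "- 3 / 4 \<le> real n * (- 1 / (2 * real N))"
      using N(1) by (auto simp: n_def field_simps)
    ultimately have "real n * x \<le> 3 / 2" "- 3 / 4 \<le> real n * x" by linarith+
    moreover have "k = real n / 2 + 1 / 2" by (simp add: k_def n_def field_simps)
    ultimately show ?thesis by (simp add: \<mu>_def)
  qed
  have disjoint: "\<not> (optimal_ordering n M X k \<sigma> \<and> optimal_ordering n M' X' k \<sigma>)" for \<sigma>
  proof
    assume opt: "optimal_ordering n M X k \<sigma> \<and> optimal_ordering n M' X' k \<sigma>"
    then have \<sigma>: "\<sigma> permutes {1..n}" by (simp add: optimal_ordering_def)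
    have perm: "\<sigma> \<circ> Transposition.transpose 1 j permutes {1..n}" if "j \<in> {2..n}" for j
      using that by (intro permutes_compose[OF permutes_swap_id \<sigma>]) auto
    have le: "upper_tail (Suc (N + 2)) (ordering_gf \<alpha> \<beta> n a b \<tau>) \<le> upper_tail (Suc (N + 2)) (ordering_gf \<alpha> \<beta> n a b \<sigma>)"
      "upper_tail (Suc (N + 2)) (ordering_gf \<alpha> \<beta> n a b' \<tau>) \<le> upper_tail (Suc (N + 2)) (ordering_gf \<alpha> \<beta> n a b' \<sigma>)"
      if \<tau>: "\<tau> permutes {1..n}" for \<tau>
      using opt \<tau> unfolding optimal_ordering_def k_def
        linear_model_prob_score_ge[OF M \<tau>, symmetric] linear_model_prob_score_ge[OF M \<sigma>, symmetric]
        linear_model_prob_score_ge[OF M' \<tau>, symmetric] linear_model_prob_score_ge[OF M' \<sigma>, symmetric]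
      by blast+
    show False
    proof (cases "\<sigma> 1 = 1")
      case True
      have j: "2 \<in> {2..n}" by (simp add: n_def)
      have "g * h * gain x' \<ge> 0"
        using swap_with_ace[OF \<alpha> \<sigma> j, where x = x' and h = h and g = g and l = "N + 2" and \<beta> = \<beta>] le(2)[OF perm[OF j]] True
        unfolding a_def[symmetric] b'_def[symmetric] gain_def n_def by auto
      moreover have "g * h * gain x' < 0" using g h sign by (simp add: mult_pos_neg)
      ultimately show False by simp
    next
      case False
      obtain j where j: "\<sigma> j = 1" using permutes_surj[OF \<sigma>] by (metis surj_def)
      have "j \<in> {1..n}" using j False permutes_not_in[OF \<sigma>, of j] by (metis n1 atLeastAtMost_iff order_refl)
      moreover have "j \<noteq> 1" using j False by auto
      ultimately have j2: "j \<in> {2..n}" by auto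
      have "g * g * gain x \<le> 0"
        using swap_with_ace[OF \<alpha> \<sigma> j2, where x = x and h = g and g = g and l = "N + 2" and \<beta> = \<beta>] le(1)[OF perm[OF j2]] False j
        unfolding a_def[symmetric] b_def[symmetric] gain_def n_def by auto
      moreover have "g * g * gain x > 0" using g sign by simp
      ultimately show False by simp
    qed
  qed
  show ?thesis
  proof (intro exI conjI allI impI)
    show "linear_model \<alpha> \<beta> n a b M X" "linear_model \<alpha> \<beta> n a b' M' X'" by fact+
    show "expected_score n M X \<sigma> = \<mu>" "expected_score n M' X' \<sigma> = \<mu>" if "\<sigma> permutes {1..n}" for \<sigma>
      using E[OF that] by simp_all
    show "\<exists>k \<in> half_integers_upto n. k \<in> {\<mu> - 2<..<\<mu> + 2.5} \<and>
           \<not> (\<exists>\<sigma>. optimal_ordering n M X k \<sigma> \<and> optimal_ordering n M' X' k \<sigma>)"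
      using k kmu disjoint by blast
  qed
qed

theorem theorem5:
  fixes \<alpha> \<beta> :: real
  assumes "\<alpha> > 0" and "\<beta> \<in> {0<..<1 / 2}"
  shows
    "(\<forall>n a b (M :: 'w measure) X. linear_model \<alpha> \<beta> n a b M X \<longrightarrow>
        (\<exists>\<mu>. (\<forall>\<sigma>. \<sigma> permutes {1..n} \<longrightarrow> expected_score n M X \<sigma> = \<mu>) \<and>
             (\<forall>k \<in> half_integers_upto n.
                (k \<ge> \<mu> + 2.5 \<longrightarrow> optimal_ordering n M X k strong_vs_strong) \<and>
                (k \<le> \<mu> - 2 \<longrightarrow> optimal_ordering n M X k (strong_vs_weak n)))))
     \<and>
     (\<exists>n a b a' b' (M :: (nat \<times> nat \<Rightarrow> real) measure) X (M' :: (nat \<times> nat \<Rightarrow> real) measure) X' \<mu>.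
        linear_model \<alpha> \<beta> n a b M X \<and>
        linear_model \<alpha> \<beta> n a' b' M' X' \<and>
        (\<forall>\<sigma>. \<sigma> permutes {1..n} \<longrightarrow> expected_score n M X \<sigma> = \<mu> \<and> expected_score n M' X' \<sigma> = \<mu>) \<and>
        (\<exists>k \<in> half_integers_upto n. k \<in> {\<mu> - 2<..<\<mu> + 2.5} \<and>
           \<not> (\<exists>\<sigma>. optimal_ordering n M X k \<sigma> \<and> optimal_ordering n M' X' k \<sigma>)))"
proof (intro conjI allI impI)
  have \<beta>: "0 < \<beta>" "\<beta> < 1 / 2" using assms(2) by auto
  show "\<exists>\<mu>. (\<forall>\<sigma>. \<sigma> permutes {1..n} \<longrightarrow> expected_score n M X \<sigma> = \<mu>) \<and>
             (\<forall>k \<in> half_integers_upto n.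
                (k \<ge> \<mu> + 2.5 \<longrightarrow> optimal_ordering n M X k strong_vs_strong) \<and>
                (k \<le> \<mu> - 2 \<longrightarrow> optimal_ordering n M X k (strong_vs_weak n)))"
    if lm: "linear_model \<alpha> \<beta> n a b M X" for n a b and M :: "'w measure" and X
  proof (intro exI conjI allI impI ballI)
    show "expected_score n M X \<sigma> = real n / 2 + (\<Sum>i = 1..n. \<alpha> * (b i - a i))"
      if "\<sigma> permutes {1..n}" for \<sigma>
      using linear_model_expected_score[OF lm that] sum_offsets_permutes[OF that, of \<alpha> b a] by simp
  qed (use linear_model_optimal[OF lm assms(1) \<beta>] in auto)
  show "\<exists>n a b a' b' (M :: (nat \<times> nat \<Rightarrow> real) measure) X (M' :: (nat \<times> nat \<Rightarrow> real) measure) X' \<mu>.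
        linear_model \<alpha> \<beta> n a b M X \<and>
        linear_model \<alpha> \<beta> n a' b' M' X' \<and>
        (\<forall>\<sigma>. \<sigma> permutes {1..n} \<longrightarrow> expected_score n M X \<sigma> = \<mu> \<and> expected_score n M' X' \<sigma> = \<mu>) \<and>
        (\<exists>k \<in> half_integers_upto n. k \<in> {\<mu> - 2<..<\<mu> + 2.5} \<and>
           \<not> (\<exists>\<sigma>. optimal_ordering n M X k \<sigma> \<and> optimal_ordering n M' X' k \<sigma>))"
    by (rule optimum_depends_on_teams[OF assms(1) \<beta>])
qed

end
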